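(* Let $X_1,X_2,\dots$ be real independent random variables such that $E(X_j)=0$, $E(X_j^2)=1$ for all $j$, and such that for some constant $\tau>0$, $$\sup_k E\big(|X_k|^3\exp(|X_k|/\tau)\big)\le\tau .$$ Let $(r_n)$ be a sequence of positive integers with $r_n\to\infty$ and $$\frac{(\log n)^2}{n}\,r_n^3\to0\quad\text{as } n\to\infty .$$ Define $$S_{n,k}=\sqrt{\frac2n}\sum_{j=1}^n\cos\Big(\frac{2\pi jk}{n}\Big)X_j,\qquad k=1,2,\dots,r_n .$$ Then for every $x\in\mathbb R$, $$\frac1{\sqrt{r_n}}\sum_{k=1}^{r_n}\big(1_{\{S_{n,k}\le x\}}-\Phi(x)\big)\Rightarrow N\big(0,\Phi(x)(1-\Phi(x))\big)\quad\text{as } n\to\infty .$$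
   Context: $\Phi$ is the standard normal cumulative distribution function; $N(m,\sigma^2)$ is the normal law with mean $m$ and variance $\sigma^2$; $\Rightarrow$ denotes weak convergence of laws (convergence in distribution). *)

theory Defs
  imports "HOL-Probability.Probability"
begin

abbreviation std_normal_cdf :: "real \<Rightarrow> real" where
  "std_normal_cdf \<equiv> cdf std_normal_distribution"

(* The second argument is the variance, whereas normal_density takes the standard
   deviation. Meaningful only for positive variance. *)
definition normal_law :: "real \<Rightarrow> real \<Rightarrow> real measure" where
  "normal_law m v = density lborel (normal_density m (sqrt v))"

definition cos_transform :: "(nat \<Rightarrow> 'a \<Rightarrow> real) \<Rightarrow> nat \<Rightarrow> nat \<Rightarrow> 'a \<Rightarrow> real" where
  "cos_transform X n k \<omega> =
     sqrt (2 / real n) * (\<Sum>j = 1..n. cos (2 * pi * real j * real k / real n) * X j \<omega>)"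

end

theory Submission
  imports Defs
begin

text \<open>
  Write \<open>S k\<close> for the transform at frequency \<open>k\<close> and \<open>N\<close> for the number of indices \<open>k \<le> r\<close> with
  \<open>S k \<le> x\<close>. The vectors \<open>(sqrt (2/n) * cos (2 * pi * j * k / n))\<^sub>j\<close> are orthonormal for
  \<open>0 < k < n / 2\<close>, so if the \<open>X j\<close> were standard normal, the \<open>S k\<close> would be independent standard
  normal variables and the claim would be the central limit theorem for Bernoulli variables.
  It remains to show that the characteristic function of \<open>N / sqrt r\<close> changes by \<open>o(1)\<close> when the
  laws of the \<open>X j\<close> are replaced by the normal law.

  The replacement is done one variable at a time (Lindeberg). As \<open>N\<close> is discontinuous, the
  indicator of \<open>S k \<le> x\<close> is first replaced by a smooth step of width
  \<open>\<epsilon> = \<delta> / sqrt r\<close>. A swap of one variable costs a third absolute moment times the mean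
  of the third derivative of \<open>exp (i * u * N / sqrt r)\<close> with respect to that variable, which enters
  each \<open>S k\<close> with a coefficient of modulus at most \<open>sqrt (2/n)\<close>. The derivatives of the step
  are of size \<open>\<epsilon>\<^sup>-\<^sup>1\<close>, \<open>\<epsilon>\<^sup>-\<^sup>2\<close>, \<open>\<epsilon>\<^sup>-\<^sup>3\<close>, but they live on the event that \<open>S k\<close> is within
  \<open>O(\<epsilon>)\<close> of \<open>x\<close>. If up to three such events together have probability
  \<open>O(\<epsilon>\<^sup>m)\<close>, \<open>m\<close> being the number of distinct indices, then the third derivative has mean
  \<open>O((r / n) powr (3/2))\<close>, the \<open>n\<close> swaps cost \<open>O(sqrt (r\<^sup>3 / n))\<close> for fixed \<open>\<delta>\<close>, which tends to zero,
  and smoothing costs \<open>O(sqrt r * \<epsilon>) = O(\<delta>)\<close>. Finally \<open>\<delta>\<close> is taken small.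

  The probability bound (lemma \<open>anticoncentration\<close>) is obtained from characteristic functions.
  The Gaussian kernel is its own Fourier transform up to scaling, so the expectation of a
  product of kernels is an average of joint characteristic functions of the \<open>S k\<close>; these
  factorise over \<open>j\<close> and decay like a Gaussian as long as no argument exceeds a constant.
  The arguments are of order \<open>1 / (\<epsilon> * sqrt n)\<close>, and \<open>r\<^sup>3 = o(n)\<close> makes the remaining region negligible.
\<close>

section \<open>Standardized laws\<close>

text \<open>The class of laws that may be exchanged for each other: for \<open>\<beta> \<ge> 2\<close> it contains the standard
  normal law, and all bounds below depend on a law through \<open>\<beta>\<close> only.\<close>

definition standardized_law :: "real \<Rightarrow> real measure \<Rightarrow> bool" where
  "standardized_law \<beta> \<mu> \<longleftrightarrow> real_distribution \<mu> \<and> integrable \<mu> (\<lambda>t. \<bar>t\<bar> ^ 3) \<and>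
     (\<integral>t. t \<partial>\<mu>) = 0 \<and> (\<integral>t. t\<^sup>2 \<partial>\<mu>) = 1 \<and> (\<integral>t. \<bar>t\<bar> ^ 3 \<partial>\<mu>) \<le> \<beta>"

lemma standardized_lawD:
  assumes "standardized_law \<beta> \<mu>"
  shows "real_distribution \<mu>" "prob_space \<mu>" "sets \<mu> = sets borel" "integrable \<mu> (\<lambda>t. \<bar>t\<bar> ^ 3)"
    "integrable \<mu> (\<lambda>t. t)" "integrable \<mu> (\<lambda>t. t\<^sup>2)"
    "(\<integral>t. t \<partial>\<mu>) = 0" "(\<integral>t. t\<^sup>2 \<partial>\<mu>) = 1" "(\<integral>t. \<bar>t\<bar> ^ 3 \<partial>\<mu>) \<le> \<beta>"
proof -
  interpret real_distribution \<mu> using assms by (simp add: standardized_law_def)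
  show "real_distribution \<mu>" "prob_space \<mu>" by unfold_locales
  show "sets \<mu> = sets borel" by simp
  show 3: "integrable \<mu> (\<lambda>t. \<bar>t\<bar> ^ 3)" and "(\<integral>t. t \<partial>\<mu>) = 0" "(\<integral>t. t\<^sup>2 \<partial>\<mu>) = 1"
    "(\<integral>t. \<bar>t\<bar> ^ 3 \<partial>\<mu>) \<le> \<beta>"
    using assms by (auto simp: standardized_law_def)
  have i: "integrable \<mu> (\<lambda>t. 1 + \<bar>t\<bar> ^ 3)" using 3 by simp
  have "\<bar>t\<bar> \<le> 1 + \<bar>t\<bar> ^ 3" "\<bar>t\<bar>\<^sup>2 \<le> 1 + \<bar>t\<bar> ^ 3" for t :: real
  proof -
    have le: "\<bar>t\<bar> ^ k \<le> 1 + \<bar>t\<bar> ^ 3" if "k \<le> 3" for k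
    proof (cases "\<bar>t\<bar> \<le> 1")
      case True
      have "\<bar>t\<bar> ^ k \<le> 1" using True by (intro power_le_one) auto
      also have "1 \<le> 1 + \<bar>t\<bar> ^ 3" by simp
      finally show ?thesis .
    next
      case False
      then have "\<bar>t\<bar> ^ k \<le> \<bar>t\<bar> ^ 3" using that by (intro power_increasing) auto
      then show ?thesis by simp
    qed
    show "\<bar>t\<bar> \<le> 1 + \<bar>t\<bar> ^ 3" "\<bar>t\<bar>\<^sup>2 \<le> 1 + \<bar>t\<bar> ^ 3" using le[of 1] le[of 2] by simp_all
  qed
  then show "integrable \<mu> (\<lambda>t. t)" "integrable \<mu> (\<lambda>t. t\<^sup>2)"
    by (auto intro!: Bochner_Integration.integrable_bound[OF i])
qed

lemma standardized_law_mono: "standardized_law \<beta> \<mu> \<Longrightarrow> \<beta> \<le> \<beta>' \<Longrightarrow> standardized_law \<beta>' \<mu>"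
  by (auto simp: standardized_law_def)

lemma standardized_law_std_normal: "standardized_law 2 std_normal_distribution"
proof -
  have 3: "has_bochner_integral std_normal_distribution (\<lambda>t. \<bar>t\<bar> ^ 3) (sqrt (2 / pi) * 2)"
    using std_normal_moment_abs_odd[of 1] 
    by (subst has_bochner_integral_density) (simp_all add: numeral_3_eq_3)
  have "sqrt (2 / pi) \<le> 1" using pi_gt3 by simp
  moreover have "(\<integral>t. t \<partial>std_normal_distribution) = 0"
    using integral_std_normal_distribution_moment_odd[of 1] by simp
  moreover have "(\<integral>t. t\<^sup>2 \<partial>std_normal_distribution) = 1"
    using std_normal_distribution_even_moments(1)[of 1] by (simp add: power2_eq_square)
  ultimately show ?thesis
    using 3 by (auto simp: standardized_law_def real_dist_normal_dist has_bochner_integral_iff)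
qed

text \<open>Unit variance gives \<open>1 - t\<^sup>2 / 2\<close> to second order, and for small \<open>t\<close> the third moment spoils at most
  half of the quadratic term. The bound is uniform over all laws with the same \<open>\<beta>\<close>, hence valid for
  the mixed families that occur between the swaps.\<close>

lemma norm_char_standardized_le:
  assumes "standardized_law \<beta> \<mu>" "\<bar>t\<bar> \<le> 1" "\<bar>t\<bar> * \<beta> \<le> 3 / 2"
  shows "norm (char \<mu> t) \<le> exp (- t\<^sup>2 / 4)"
proof -
  note L = standardized_lawD[OF assms(1)]
  interpret real_distribution \<mu> by (rule L)
  have "norm (char \<mu> t - (1 - t\<^sup>2 * 1 / 2)) \<le>
      (t\<^sup>2 / 6) * expectation (\<lambda>x. min (6 * x\<^sup>2) (\<bar>t\<bar> * \<bar>x\<bar> ^ 3))"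
    using L by (intro char_approx3) auto
  also have "expectation (\<lambda>x. min (6 * x\<^sup>2) (\<bar>t\<bar> * \<bar>x\<bar> ^ 3)) \<le> expectation (\<lambda>x. \<bar>t\<bar> * \<bar>x\<bar> ^ 3)"
  proof (rule integral_mono)
    show i: "integrable \<mu> (\<lambda>x. \<bar>t\<bar> * \<bar>x\<bar> ^ 3)" using L(4) by simp
    show "integrable \<mu> (\<lambda>x. min (6 * x\<^sup>2) (\<bar>t\<bar> * \<bar>x\<bar> ^ 3))"
      by (rule Bochner_Integration.integrable_bound[OF i]) auto
  qed simp
  also have "\<dots> \<le> \<bar>t\<bar> * \<beta>"
    using L by (simp add: mult_left_mono)
  also have "\<dots> \<le> 3 / 2" by (rule assms)
  finally have "norm (char \<mu> t - of_real (1 - t\<^sup>2 / 2)) \<le> t\<^sup>2 / 4"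
    by (simp add: mult_left_mono)
  moreover have "norm (of_real (1 - t\<^sup>2 / 2) :: complex) = 1 - t\<^sup>2 / 2"
  proof -
    have "t\<^sup>2 \<le> 1" using assms(2) by (simp add: abs_square_le_1)
    then show ?thesis unfolding norm_of_real by simp
  qed
  ultimately have "norm (char \<mu> t) \<le> 1 + (- t\<^sup>2 / 4)"
    using norm_triangle_sub[of "char \<mu> t" "of_real (1 - t\<^sup>2 / 2)"] by simp
  also have "\<dots> \<le> exp (- t\<^sup>2 / 4)" by (rule exp_ge_add_one_self)
  finally show ?thesis .
qed

section \<open>The standard normal distribution function\<close>

lemma DERIV_std_normal_cdf:
  "(std_normal_cdf has_real_derivative std_normal_density y) (at y)"
proof -
  interpret real_distribution std_normal_distribution by (rule real_dist_normal_dist)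
  let ?a = "y - 1" and ?b = "y + 1"
  have eq: "std_normal_cdf z = std_normal_cdf ?a + integral {?a..z} std_normal_density"
    if "z \<in> {?a<..<?b}" for z
  proof -
    have "std_normal_cdf z - std_normal_cdf ?a = measure std_normal_distribution {?a<..z}"
      using that by (intro cdf_diff_eq) auto
    also have "\<dots> = (\<integral>x. indicator {?a<..z} x \<partial>std_normal_distribution)" by simp
    also have "\<dots> = (LINT x:{?a<..z}|lborel. std_normal_density x)"
      by (subst integral_density) (auto simp: set_lebesgue_integral_def mult.commute)
    also have "\<dots> = integral {?a<..z} std_normal_density"
    proof (rule set_borel_integral_eq_integral(2))
      show "set_integrable lborel {?a<..z} std_normal_density"
        unfolding set_integrable_def by (rule integrable_mult_indicator) auto
    qed
    also have "\<dots> = integral {?a..z} std_normal_density"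
    proof (rule integral_spike_set)
      show "negligible {x \<in> {?a<..z} - {?a..z}. std_normal_density x \<noteq> 0}"
        by (rule negligible_subset[OF negligible_sing[of ?a]]) auto
      show "negligible {x \<in> {?a..z} - {?a<..z}. std_normal_density x \<noteq> 0}"
        by (rule negligible_subset[OF negligible_sing[of ?a]]) auto
    qed
    finally show ?thesis by simp
  qed
  have "((\<lambda>z. integral {?a..z} std_normal_density) has_real_derivative std_normal_density y)
      (at y within {?a..?b})"
    by (intro integral_has_real_derivative)
       (auto simp: std_normal_density_def intro!: continuous_intros)
  then have "((\<lambda>z. integral {?a..z} std_normal_density) has_real_derivative std_normal_density y) (at y)"
    by (simp add: at_within_Icc_at)
  then have "((\<lambda>z. std_normal_cdf ?a + integral {?a..z} std_normal_density)
      has_real_derivative std_normal_density y) (at y)"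
    by (auto intro!: derivative_eq_intros)
  moreover have "eventually (\<lambda>z. std_normal_cdf z = std_normal_cdf ?a + integral {?a..z} std_normal_density) (nhds y)"
    by (rule eventually_mono[OF eventually_nhds_in_open[of "{?a<..<?b}" y] eq]) auto
  ultimately show ?thesis
    by (subst DERIV_cong_ev[OF refl _ refl])
qed

lemma std_normal_cdf_strict: "0 < std_normal_cdf x" "std_normal_cdf x < 1"
proof -
  interpret real_distribution std_normal_distribution by (rule real_dist_normal_dist)
  have mono: "std_normal_cdf a < std_normal_cdf b" if "a < b" for a b
  proof (rule DERIV_pos_imp_increasing[OF that])
    fix y show "\<exists>D. (std_normal_cdf has_real_derivative D) (at y) \<and> 0 < D"
      by (intro exI[of _ "std_normal_density y"] conjI DERIV_std_normal_cdf normal_density_pos) simp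
  qed
  show "0 < std_normal_cdf x" using mono[of "x - 1" x] cdf_nonneg[of "x - 1"] by simp
  show "std_normal_cdf x < 1" using mono[of x "x + 1"] cdf_bounded_prob[of "x + 1"] by simp
qed

text \<open>For \<open>y \<le> - a\<close> the standard density is at most \<open>exp (- a\<^sup>2 / 2)\<close> times the normal density centred at
  \<open>- a\<close>, which integrates to one.\<close>

lemma std_normal_cdf_lower_tail:
  assumes "a \<ge> 0"
  shows "std_normal_cdf (- a) \<le> exp (- a\<^sup>2 / 2)"
proof -
  have "std_normal_cdf (- a) = (\<integral>y. indicator {..-a} y \<partial>std_normal_distribution)"
    by (simp add: cdf_def)
  also have "\<dots> = (\<integral>y. indicator {..-a} y * std_normal_density y \<partial>lborel)"
    by (subst integral_density) (auto simp: mult.commute)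
  also have "\<dots> \<le> (\<integral>y. exp (- a\<^sup>2 / 2) * normal_density (-a) 1 y \<partial>lborel)"
  proof (rule integral_mono)
    show "integrable lborel (\<lambda>y. indicat_real {..- a} y * std_normal_density y)"
      using integrable_mult_indicator[of "{..-a}" lborel std_normal_density] by simp
    fix y
    have "std_normal_density y \<le> exp (- a\<^sup>2 / 2) * normal_density (-a) 1 y" if "y \<le> -a"
    proof -
      have "a * y \<le> a * - a" using that assms by (intro mult_left_mono) auto
      then have "- y\<^sup>2 / 2 \<le> - a\<^sup>2 / 2 + - (y + a)\<^sup>2 / 2"
        by (simp add: power2_eq_square algebra_simps)
      then have "exp (- y\<^sup>2 / 2) \<le> exp (- a\<^sup>2 / 2) * exp (- (y + a)\<^sup>2 / 2)"
        by (simp add: exp_add[symmetric])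
      then show ?thesis
        by (simp add: normal_density_def divide_right_mono)
    qed
    then show "indicat_real {..- a} y * std_normal_density y \<le> exp (- a\<^sup>2 / 2) * normal_density (-a) 1 y"
      by (auto simp: indicator_def)
  qed auto
  finally show ?thesis by simp
qed

text \<open>By symmetry: the sum of the values at \<open>a\<close> and \<open>- a\<close> has derivative zero and limit one.\<close>

lemma std_normal_cdf_upper_tail:
  assumes "a \<ge> 0"
  shows "1 - std_normal_cdf a \<le> exp (- a\<^sup>2 / 2)"
proof -
  interpret real_distribution std_normal_distribution by (rule real_dist_normal_dist)
  let ?g = "\<lambda>a. std_normal_cdf a + std_normal_cdf (- a)"
  have "(?g has_real_derivative 0) (at y)" for y
  proof -
    have "(std_normal_cdf has_real_derivative std_normal_density (-y)) (at (-y))"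
      by (rule DERIV_std_normal_cdf)
    then have "((\<lambda>y. std_normal_cdf (- y)) has_real_derivative std_normal_density (-y) * -1) (at y)"
      by (rule DERIV_chain2) (auto intro!: derivative_eq_intros)
    from DERIV_add[OF DERIV_std_normal_cdf[of y] this] show ?thesis by (simp add: std_normal_density_def)
  qed
  then have const: "?g y = ?g a" for y
    by (intro DERIV_isconst_all) auto
  have "((\<lambda>y. ?g y) \<longlongrightarrow> 1 + 0) at_top"
    by (intro tendsto_add cdf_lim_at_top_prob filterlim_compose[OF cdf_lim_at_bot] filterlim_uminus_at_bot_at_top)
  moreover have "((\<lambda>y. ?g y) \<longlongrightarrow> ?g a) at_top"
    by (rule tendsto_eventually) (use const in \<open>auto intro: always_eventually\<close>)
  ultimately have "?g a = 1" by (intro tendsto_unique[of at_top ?g]) auto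
  with std_normal_cdf_lower_tail[OF assms] show ?thesis by simp
qed

section \<open>The Gaussian kernel and a smooth step\<close>

definition gauss_kernel :: "real \<Rightarrow> real" where
  "gauss_kernel z = exp (- z\<^sup>2 / 2)"

lemma gauss_kernel_pos: "0 < gauss_kernel z"
  and gauss_kernel_le_1: "gauss_kernel z \<le> 1"
  and gauss_kernel_measurable [measurable]: "gauss_kernel \<in> borel_measurable borel"
  by (auto simp: gauss_kernel_def[abs_def])

text \<open>A decreasing smooth version of the indicator of \<open>z \<le> 0\<close>, together with its first three derivatives.
  The factor \<open>sqrt 2\<close> makes the derivatives polynomials times \<open>exp (- z\<^sup>2)\<close>, so that they are
  dominated by \<open>gauss_kernel\<close> in spite of the polynomial factors. The last clause is the third derivative;
  for larger indices it is an arbitrary value.\<close>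

fun smooth_step :: "nat \<Rightarrow> real \<Rightarrow> real" where
  "smooth_step 0 z = std_normal_cdf (- sqrt 2 * z)"
| "smooth_step (Suc 0) z = - exp (- z\<^sup>2) / sqrt pi"
| "smooth_step (Suc (Suc 0)) z = 2 * z * exp (- z\<^sup>2) / sqrt pi"
| "smooth_step (Suc (Suc (Suc i))) z = (2 - 4 * z\<^sup>2) * exp (- z\<^sup>2) / sqrt pi"

lemma DERIV_smooth_step:
  assumes "i < 3"
  shows "(smooth_step i has_real_derivative smooth_step (Suc i) z) (at z)"
proof -
  consider "i = 0" | "i = Suc 0" | "i = Suc (Suc 0)" using assms by linarith
  then show ?thesis
  proof cases
    case 1
    have "((\<lambda>z. - sqrt 2 * z) has_real_derivative - sqrt 2) (at z)"
      by (auto intro!: derivative_eq_intros)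
    then have "((\<lambda>z. std_normal_cdf (- sqrt 2 * z)) has_real_derivative
        std_normal_density (- sqrt 2 * z) * (- sqrt 2)) (at z)"
      by (rule DERIV_chain2[OF DERIV_std_normal_cdf])
    moreover have "std_normal_density (- sqrt 2 * z) * (- sqrt 2) = smooth_step (Suc 0) z"
      by (simp add: std_normal_density_def power_mult_distrib real_sqrt_mult field_simps)
    moreover have "smooth_step 0 = (\<lambda>z. std_normal_cdf (- sqrt 2 * z))" by (rule ext) simp
    ultimately show ?thesis using 1 by simp
  next
    case 2
    have "smooth_step (Suc 0) = (\<lambda>z. - exp (- z\<^sup>2) / sqrt pi)" by (rule ext) simp
    then show ?thesis using 2 by (auto intro!: derivative_eq_intros simp: field_simps)
  next
    case 3
    have pi: "sqrt pi * (sqrt pi * x) = pi * x" for x :: real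
      by (simp add: mult.assoc[symmetric])
    have "smooth_step (Suc (Suc 0)) = (\<lambda>z. 2 * z * exp (- z\<^sup>2) / sqrt pi)" by (rule ext) simp
    then show ?thesis using 3
      by (auto intro!: derivative_eq_intros simp: power2_eq_square field_simps pi)
  qed
qed

text \<open>The quotient of the two kernels, \<open>exp (- z\<^sup>2 / 2)\<close>, absorbs the polynomial factor, which is at most
  \<open>2 + 4 * z\<^sup>2 \<le> 8 * (1 + z\<^sup>2 / 2)\<close>.\<close>

lemma abs_smooth_step_le:
  assumes "i > 0"
  shows "\<bar>smooth_step i z\<bar> \<le> 8 * gauss_kernel z"
proof -
  have K: "(2 + 4 * z\<^sup>2) * exp (- z\<^sup>2) \<le> 8 * gauss_kernel z"
  proof -
    have "2 + 4 * z\<^sup>2 \<le> 8 * (1 + z\<^sup>2 / 2)" by simp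
    also have "\<dots> \<le> 8 * exp (z\<^sup>2 / 2)" by (intro mult_left_mono exp_ge_add_one_self) auto
    finally have "(2 + 4 * z\<^sup>2) * exp (- z\<^sup>2) \<le> 8 * exp (z\<^sup>2 / 2) * exp (- z\<^sup>2)"
      by (intro mult_right_mono) auto
    also have "\<dots> = 8 * gauss_kernel z"
      by (simp add: gauss_kernel_def mult_exp_exp)
    finally show ?thesis .
  qed
  have *: "\<bar>c * exp (- z\<^sup>2) / sqrt pi\<bar> \<le> 8 * gauss_kernel z" if "\<bar>c\<bar> \<le> 2 + 4 * z\<^sup>2" for c
  proof -
    have "\<bar>c * exp (- z\<^sup>2) / sqrt pi\<bar> \<le> \<bar>c * exp (- z\<^sup>2)\<bar> / 1"
      unfolding abs_divide using pi_gt3 by (intro divide_left_mono) auto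
    also have "\<dots> \<le> (2 + 4 * z\<^sup>2) * exp (- z\<^sup>2)"
      using that by (simp add: abs_mult)
    finally show ?thesis using K by linarith
  qed
  have z2: "\<bar>2 * z\<bar> \<le> 2 + 4 * z\<^sup>2"
  proof -
    have "0 \<le> (2 * \<bar>z\<bar> - 1 / 2)\<^sup>2" by simp
    also have "\<dots> = 4 * z\<^sup>2 - 2 * \<bar>z\<bar> + 1 / 4" by (simp add: power2_eq_square algebra_simps)
    finally show ?thesis by (simp add: abs_mult)
  qed
  obtain j where i: "i = Suc j" using assms by (cases i) auto
  consider "j = 0" | "j = Suc 0" | k where "j = Suc (Suc k)" by (metis not0_implies_Suc)
  then show ?thesis
  proof cases
    case 1 then show ?thesis using *[of "-1"] i by simp
  next
    case 2 then show ?thesis using *[of "2 * z"] z2 i by simp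
  next
    case 3 then show ?thesis using *[of "2 - 4 * z\<^sup>2"] i by (simp add: abs_le_iff)
  qed
qed

lemma smooth_step_approx: "\<bar>smooth_step 0 z - indicat_real {..0} z\<bar> \<le> gauss_kernel z"
proof -
  interpret real_distribution std_normal_distribution by (rule real_dist_normal_dist)
  have *: "exp (- (sqrt 2 * \<bar>z\<bar>)\<^sup>2 / 2) \<le> gauss_kernel z"
    by (simp add: power_mult_distrib gauss_kernel_def)
  show ?thesis
  proof (cases "z \<le> 0")
    case True
    have "1 - std_normal_cdf (sqrt 2 * \<bar>z\<bar>) \<le> exp (- (sqrt 2 * \<bar>z\<bar>)\<^sup>2 / 2)"
      by (rule std_normal_cdf_upper_tail) simp
    then show ?thesis using * True cdf_bounded_prob[of "sqrt 2 * \<bar>z\<bar>"] by simp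
  next
    case False
    have "std_normal_cdf (- (sqrt 2 * \<bar>z\<bar>)) \<le> exp (- (sqrt 2 * \<bar>z\<bar>)\<^sup>2 / 2)"
      by (rule std_normal_cdf_lower_tail) simp
    then show ?thesis using * False cdf_nonneg[of "- (sqrt 2 * \<bar>z\<bar>)"] by simp
  qed
qed

lemma continuous_on_smooth_step: "continuous_on UNIV (smooth_step i)"
proof (cases "i < 3")
  case True
  then show ?thesis
    by (intro DERIV_continuous_on[where D = "smooth_step (Suc i)"]) (auto intro: DERIV_smooth_step)
next
  case False
  then have "i = Suc (Suc (Suc (i - 3)))" by simp
  then obtain j where "i = Suc (Suc (Suc j))" ..
  then have "smooth_step i = (\<lambda>z. (2 - 4 * z\<^sup>2) * exp (- z\<^sup>2) / sqrt pi)" by auto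
  then show ?thesis by (auto intro!: continuous_intros)
qed

lemma smooth_step_measurable [measurable]: "smooth_step i \<in> borel_measurable borel"
  by (intro borel_measurable_continuous_onI continuous_on_smooth_step)

section \<open>Exchanging the law of one variable\<close>

text \<open>A bound for the third derivative of \<open>exp (i * \<theta> * Y 0)\<close>, where \<open>Y 1\<close>, \<open>Y 2\<close>, \<open>Y 3\<close> are the derivatives
  of \<open>Y 0\<close>.\<close>

definition phase_weight :: "real \<Rightarrow> (nat \<Rightarrow> real \<Rightarrow> real) \<Rightarrow> real \<Rightarrow> real" where
  "phase_weight \<theta> Y s = \<bar>\<theta>\<bar> * \<bar>Y 3 s\<bar> + 3 * \<theta>\<^sup>2 * \<bar>Y 1 s\<bar> * \<bar>Y 2 s\<bar> + \<bar>\<theta>\<bar> ^ 3 * \<bar>Y 1 s\<bar> ^ 3"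

text \<open>Taylor's formula with integral remainder. The supremum of the third derivative between \<open>0\<close> and \<open>t\<close>
  would be useless here: the derivative is small only on average over the remaining variables,
  for each fixed intermediate point, and the integral form allows this average to be taken first.\<close>

lemma phase_taylor:
  fixes Y :: "nat \<Rightarrow> real \<Rightarrow> real"
  assumes Y: "\<And>i s. i < 3 \<Longrightarrow> (Y i has_real_derivative Y (Suc i) s) (at s)"
    and cont: "continuous_on UNIV (Y 3)"
  obtains a b where "\<And>t. ennreal (norm (iexp (\<theta> * Y 0 t) - (iexp (\<theta> * Y 0 0) + of_real t * a + of_real (t\<^sup>2) * b)))
      \<le> (\<integral>\<^sup>+s\<in>{0..1}. ennreal (\<bar>t\<bar> ^ 3 / 2 * phase_weight \<theta> Y (t * s)) \<partial>lborel)"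
proof -
  define p where "p i s = complex_of_real (Y i s)" for i s
  define E where "E s = iexp (\<theta> * Y 0 s)" for s
  define c where "c = \<i> * complex_of_real \<theta>"
  define D where "D i s = (if i = 0 then E s else if i = 1 then c * p 1 s * E s
    else if i = 2 then (c * p 2 s + c\<^sup>2 * (p 1 s)\<^sup>2) * E s
    else (c * p 3 s + 3 * c\<^sup>2 * p 1 s * p 2 s + c ^ 3 * (p 1 s) ^ 3) * E s)" for i :: nat and s
  have pD: "(p i has_vector_derivative p (Suc i) s) (at s)" if "i < 3" for i s
    unfolding p_def using Y[OF that] by (intro has_vector_derivative_of_real)
       (simp add: has_real_derivative_iff_has_vector_derivative)
  have pD': "(p 0 has_vector_derivative p 1 s) (at s)" "(p 1 has_vector_derivative p 2 s) (at s)"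
    "(p 2 has_vector_derivative p 3 s) (at s)" for s
    using pD[of 0 s] pD[of 1 s] pD[of 2 s] by (simp_all add: numeral_2_eq_2 numeral_3_eq_3)
  have ED: "(E has_vector_derivative c * p 1 s * E s) (at s)" for s
  proof -
    have "((\<lambda>s. exp (c * p 0 s)) has_vector_derivative c * p 1 s * exp (c * p 0 s)) (at s)"
      by (rule has_vector_derivative_eq_rhs,
          rule field_vector_diff_chain_at[where g = exp, unfolded o_def],
          rule has_vector_derivative_mult_right[OF pD'(1)], rule DERIV_exp) simp
    then show ?thesis by (simp add: E_def[abs_def] c_def p_def mult.assoc)
  qed
  have DD: "(D i has_vector_derivative D (Suc i) s) (at s)" if "i < 3" for i s
  proof -
    consider "i = 0" | "i = 1" | "i = 2" using \<open>i < 3\<close> by linarith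
    then show ?thesis
    proof cases
      case 1 then show ?thesis using ED by (simp add: D_def[abs_def])
    next
      case 2
      have "((\<lambda>s. c * p 1 s * E s) has_vector_derivative c * p 1 s * (c * p 1 s * E s) + c * p 2 s * E s) (at s)"
        by (rule has_vector_derivative_mult[OF has_vector_derivative_mult_right[OF pD'(2)] ED])
      then show ?thesis using 2 by (simp add: D_def[abs_def] numeral_2_eq_2 algebra_simps)
    next
      case 3
      have "((\<lambda>s. (c * p 2 s + c\<^sup>2 * (p 1 s * p 1 s)) * E s) has_vector_derivative
          (c * p 2 s + c\<^sup>2 * (p 1 s * p 1 s)) * (c * p 1 s * E s) +
          (c * p 3 s + c\<^sup>2 * (p 1 s * p 2 s + p 2 s * p 1 s)) * E s) (at s)"
        by (intro has_vector_derivative_mult has_vector_derivative_add has_vector_derivative_mult_right pD' ED)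
      then show ?thesis using 3
        by (simp add: D_def[abs_def] numeral_3_eq_3 power2_eq_square power3_eq_cube algebra_simps)
    qed
  qed
  have normD: "norm (D 3 s) \<le> phase_weight \<theta> Y s" for s
  proof -
    have "norm (E s) = 1" by (simp add: E_def)
    then have "norm (D 3 s) = norm (c * p 3 s + 3 * c\<^sup>2 * p 1 s * p 2 s + c ^ 3 * (p 1 s) ^ 3)"
      by (simp add: D_def norm_mult)
    also have "\<dots> \<le> norm (c * p 3 s) + norm (3 * c\<^sup>2 * p 1 s * p 2 s) + norm (c ^ 3 * (p 1 s) ^ 3)"
      by (intro order_trans[OF norm_triangle_ineq] add_right_mono norm_triangle_ineq)
    also have "\<dots> = phase_weight \<theta> Y s"
      by (simp add: norm_mult norm_power c_def p_def phase_weight_def power_mult_distrib)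
    finally show ?thesis .
  qed
  have contY: "continuous_on UNIV (Y i)" if "i \<le> 3" for i
    using that cont by (cases "i = 3") (auto intro!: DERIV_continuous_on[where D = "Y (Suc i)"] Y)
  have contw: "continuous_on UNIV (phase_weight \<theta> Y)"
    unfolding phase_weight_def by (intro continuous_intros contY) auto
  show ?thesis
  proof
    fix t :: real
    let ?G = "\<lambda>i s. of_real (t ^ i) * D i (t * s)"
    have GD: "(?G i has_vector_derivative ?G (Suc i) s) (at s within {0..1})" if "i < 3" for i s
    proof -
      have "((\<lambda>s. t * s) has_vector_derivative t) (at s)"
        by (auto intro!: derivative_eq_intros)
      from vector_diff_chain_at[OF this DD[OF that]]
      have "((\<lambda>s. D i (t * s)) has_vector_derivative t *\<^sub>R D (Suc i) (t * s)) (at s)"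
        by (simp add: o_def)
      then have "(?G i has_vector_derivative of_real (t ^ i) * (t *\<^sub>R D (Suc i) (t * s))) (at s)"
        by (rule has_vector_derivative_mult_right)
      then show ?thesis
        by (rule has_vector_derivative_at_within[OF has_vector_derivative_eq_rhs]) (simp add: scaleR_conv_of_real mult_ac)
    qed
    have T: "((\<lambda>s. ((1 - s) ^ (3 - 1) / fact (3 - 1)) *\<^sub>R ?G 3 s) has_integral
        ?G 0 1 - (\<Sum>i<3. ((1 - 0) ^ i / fact i) *\<^sub>R ?G i 0)) {0..1}"
      by (rule Taylor_has_integral[where Df = ?G], simp, rule refl, erule GD, simp)
    have cB: "continuous_on {0..1} (\<lambda>s. \<bar>t\<bar> ^ 3 / 2 * phase_weight \<theta> Y (t * s))"
      by (intro continuous_intros continuous_on_compose2[OF contw]) auto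
    have nn: "phase_weight \<theta> Y s \<ge> 0" for s by (simp add: phase_weight_def)
    let ?I = "integral {0..1} (\<lambda>s. \<bar>t\<bar> ^ 3 / 2 * phase_weight \<theta> Y (t * s))"
    have "norm (?G 0 1 - (\<Sum>i<3. ((1 - 0) ^ i / fact i) *\<^sub>R ?G i 0)) \<le> ?I"
      unfolding integral_unique[OF T, symmetric]
    proof (rule integral_norm_bound_integral)
      show "(\<lambda>s. ((1 - s) ^ (3 - 1) / fact (3 - 1)) *\<^sub>R ?G 3 s) integrable_on {0..1}"
        using T by (rule has_integral_integrable)
      show "(\<lambda>s. \<bar>t\<bar> ^ 3 / 2 * phase_weight \<theta> Y (t * s)) integrable_on {0..1}"
        by (rule integrable_continuous_real[OF cB])
      fix s :: real assume s: "s \<in> {0..1}"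
      have "norm (((1 - s) ^ (3 - 1) / fact (3 - 1)) *\<^sub>R ?G 3 s) = (1 - s)\<^sup>2 / 2 * (\<bar>t\<bar> ^ 3 * norm (D 3 (t * s)))"
        by (simp add: norm_mult norm_power power_abs)
      also have "\<dots> \<le> 1 / 2 * (\<bar>t\<bar> ^ 3 * phase_weight \<theta> Y (t * s))"
        using s by (intro mult_mono normD divide_right_mono power_le_one) auto
      finally show "norm (((1 - s) ^ (3 - 1) / fact (3 - 1)) *\<^sub>R ?G 3 s) \<le> \<bar>t\<bar> ^ 3 / 2 * phase_weight \<theta> Y (t * s)"
        by simp
    qed
    moreover have "?G 0 1 - (\<Sum>i<3. ((1 - 0) ^ i / fact i) *\<^sub>R ?G i 0) =
      iexp (\<theta> * Y 0 t) - (iexp (\<theta> * Y 0 0) + of_real t * D 1 0 + of_real (t\<^sup>2) * (D 2 0 / 2))"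
      by (simp add: numeral_3_eq_3 D_def E_def scaleR_conv_of_real algebra_simps numeral_2_eq_2)
    ultimately have "norm (iexp (\<theta> * Y 0 t) - (iexp (\<theta> * Y 0 0) + of_real t * D 1 0 + of_real (t\<^sup>2) * (D 2 0 / 2))) \<le> ?I"
      by simp
    moreover have "(\<integral>\<^sup>+s\<in>{0..1}. ennreal (\<bar>t\<bar> ^ 3 / 2 * phase_weight \<theta> Y (t * s)) \<partial>lborel) = ennreal ?I"
    proof -
      have int: "set_integrable lborel {0..1} (\<lambda>s. \<bar>t\<bar> ^ 3 / 2 * phase_weight \<theta> Y (t * s))"
        by (rule borel_integrable_compact[OF compact_Icc cB, folded set_integrable_def])
      have "(\<integral>\<^sup>+s\<in>{0..1}. ennreal (\<bar>t\<bar> ^ 3 / 2 * phase_weight \<theta> Y (t * s)) \<partial>lborel)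
        = (\<integral>\<^sup>+s. ennreal (indicator {0..1} s *\<^sub>R (\<bar>t\<bar> ^ 3 / 2 * phase_weight \<theta> Y (t * s))) \<partial>lborel)"
        by (rule nn_integral_cong) (auto simp: indicator_def)
      also have "\<dots> = ennreal (LINT s:{0..1}|lborel. \<bar>t\<bar> ^ 3 / 2 * phase_weight \<theta> Y (t * s))"
        using int unfolding set_lebesgue_integral_def set_integrable_def
        by (intro nn_integral_eq_integral) (auto simp: nn)
      finally have "(\<integral>\<^sup>+s\<in>{0..1}. ennreal (\<bar>t\<bar> ^ 3 / 2 * phase_weight \<theta> Y (t * s)) \<partial>lborel)
        = ennreal (LINT s:{0..1}|lborel. \<bar>t\<bar> ^ 3 / 2 * phase_weight \<theta> Y (t * s))" .
      then show ?thesis unfolding set_borel_integral_eq_integral(2)[OF int] .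
    qed
    ultimately show "ennreal (norm (iexp (\<theta> * Y 0 t) - (iexp (\<theta> * Y 0 0) + of_real t * D 1 0 + of_real (t\<^sup>2) * (D 2 0 / 2))))
      \<le> (\<integral>\<^sup>+s\<in>{0..1}. ennreal (\<bar>t\<bar> ^ 3 / 2 * phase_weight \<theta> Y (t * s)) \<partial>lborel)"
      by (simp add: ennreal_leI)
  qed
qed

text \<open>The mean over \<open>t\<close> of a quadratic Taylor polynomial is the same for all standardized laws, namely
  \<open>c + b\<close>, so only the remainder \<open>R\<close> distinguishes two of them.\<close>

lemma standardized_law_taylor:
  assumes \<mu>: "standardized_law \<beta> \<mu>"
    and f [measurable]: "f \<in> borel_measurable borel" and f1: "\<And>t. norm (f t) \<le> 1"
    and R: "\<And>t. ennreal (norm (f t - (c + of_real t * a + of_real (t\<^sup>2) * b))) \<le> R t"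
  shows "ennreal (norm ((\<integral>t. f t \<partial>\<mu>) - (c + b :: complex))) \<le> (\<integral>\<^sup>+t. R t \<partial>\<mu>)"
proof -
  note L = standardized_lawD[OF \<mu>]
  interpret real_distribution \<mu> by (rule L)
  have int [simp]: "integrable \<mu> f"
    by (rule integrable_const_bound[of _ 1]) (auto simp: f1)
  have i1: "integrable \<mu> (\<lambda>t. of_real t * a)" "integrable \<mu> (\<lambda>t. of_real (t\<^sup>2) * b)"
    by (rule integrable_mult_left, rule integrable_of_real, rule L(5))
       (rule integrable_mult_left, rule integrable_of_real, rule L(6))
  have e1: "(\<integral>t. of_real t * a \<partial>\<mu>) = 0"
    using L(7) by (simp only: integral_mult_left_zero integral_of_real) simp
  have "(\<integral>t. of_real (t\<^sup>2) * b \<partial>\<mu>) = (\<integral>t. of_real (t\<^sup>2) \<partial>\<mu>) * b"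
    by (rule integral_mult_left_zero)
  also have "(\<integral>t. complex_of_real (t\<^sup>2) \<partial>\<mu>) = of_real (\<integral>t. t\<^sup>2 \<partial>\<mu>)"
    by (rule integral_of_real) (rule L(6))
  finally have e2: "(\<integral>t. of_real (t\<^sup>2) * b \<partial>\<mu>) = b"
    by (simp only: L(8) of_real_1 mult_1_left)
  have "(\<integral>t. f t - (c + of_real t * a + of_real (t\<^sup>2) * b) \<partial>\<mu>) = (\<integral>t. f t \<partial>\<mu>) - (c + b)"
  proof -
    have "(\<integral>t. f t - (c + of_real t * a + of_real (t\<^sup>2) * b) \<partial>\<mu>) =
        (\<integral>t. f t \<partial>\<mu>) - ((\<integral>t. c \<partial>\<mu>) + (\<integral>t. of_real t * a \<partial>\<mu>) + (\<integral>t. of_real (t\<^sup>2) * b \<partial>\<mu>))"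
      by (intro has_bochner_integral_integral_eq has_bochner_integral_diff has_bochner_integral_add
          has_bochner_integral_integrable int integrable_const i1)
    also have "(\<integral>t. c \<partial>\<mu>) = c" using prob_space by simp
    finally show ?thesis unfolding e1 e2 by simp
  qed
  then have "ennreal (norm ((\<integral>t. f t \<partial>\<mu>) - (c + b))) =
      ennreal (norm (\<integral>t. f t - (c + of_real t * a + of_real (t\<^sup>2) * b) \<partial>\<mu>))" by simp
  also have "\<dots> \<le> (\<integral>\<^sup>+t. ennreal (norm (f t - (c + of_real t * a + of_real (t\<^sup>2) * b))) \<partial>\<mu>)"
    by (rule integral_norm_bound_ennreal)
       (intro Bochner_Integration.integrable_diff Bochner_Integration.integrable_add int integrable_const i1)
  also have "\<dots> \<le> (\<integral>\<^sup>+t. R t \<partial>\<mu>)"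
    by (rule nn_integral_mono) (rule R)
  finally show ?thesis .
qed

text \<open>One step of the replacement. Here \<open>w\<close> collects all other variables and \<open>t\<close> is the variable whose
  law is exchanged. Both expectations have the same quadratic part, and by Fubini the mean of each
  remainder is at most the third absolute moment times \<open>D / 2\<close>.\<close>

lemma (in prob_space) lindeberg_swap:
  fixes Y :: "nat \<Rightarrow> 'a \<Rightarrow> real \<Rightarrow> real"
  assumes law: "standardized_law \<beta> \<mu>" "standardized_law \<beta> \<nu>"
    and meas [measurable]: "\<And>i. i \<le> 3 \<Longrightarrow> (\<lambda>(w, s). Y i w s) \<in> borel_measurable (M \<Otimes>\<^sub>M borel)"
    and Y: "\<And>w i s. w \<in> space M \<Longrightarrow> i < 3 \<Longrightarrow> (Y i w has_real_derivative Y (Suc i) w s) (at s)"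
    and cont: "\<And>w. w \<in> space M \<Longrightarrow> continuous_on UNIV (Y 3 w)"
    and D: "\<And>s. (\<integral>\<^sup>+w. ennreal (phase_weight \<theta> (\<lambda>i. Y i w) s) \<partial>M) \<le> ennreal D" and "D \<ge> 0" 
  shows "norm ((\<integral>w. (\<integral>t. iexp (\<theta> * Y 0 w t) \<partial>\<mu>) \<partial>M) - (\<integral>w. (\<integral>t. iexp (\<theta> * Y 0 w t) \<partial>\<nu>) \<partial>M)) \<le> \<beta> * D"
proof -
  define R where "R w t = (\<integral>\<^sup>+s\<in>{0..1}. ennreal (\<bar>t\<bar> ^ 3 / 2 * phase_weight \<theta> (\<lambda>i. Y i w) (t * s)) \<partial>lborel)" for w t
  have [measurable]: "(\<lambda>p. Y 0 (fst p) (snd p)) \<in> borel_measurable (M \<Otimes>\<^sub>M borel)"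
    "(\<lambda>p. Y 1 (fst p) (snd p)) \<in> borel_measurable (M \<Otimes>\<^sub>M borel)"
    "(\<lambda>p. Y 2 (fst p) (snd p)) \<in> borel_measurable (M \<Otimes>\<^sub>M borel)"
    "(\<lambda>p. Y 3 (fst p) (snd p)) \<in> borel_measurable (M \<Otimes>\<^sub>M borel)"
    using meas[of 0] meas[of 1] meas[of 2] meas[of 3] by (simp_all add: split_beta')
  have [measurable]: "(\<lambda>p. phase_weight \<theta> (\<lambda>i. Y i (fst p)) (snd p)) \<in> borel_measurable (M \<Otimes>\<^sub>M borel)"
    unfolding phase_weight_def by measurable
  have Bm: "(\<lambda>p. phase_weight \<theta> (\<lambda>i. Y i (f p)) (g p)) \<in> borel_measurable N"
    if [measurable]: "f \<in> measurable N M" "g \<in> borel_measurable N" for f g and N :: "'c measure"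
    by (rule measurable_compose[of "\<lambda>p. (f p, g p)" N "M \<Otimes>\<^sub>M borel" "\<lambda>p. phase_weight \<theta> (\<lambda>i. Y i (fst p)) (snd p)", simplified])
       measurable
  note [measurable] = Bm
  have R_bound: "(\<integral>\<^sup>+w. (\<integral>\<^sup>+t. R w t \<partial>\<kappa>) \<partial>M) \<le> ennreal (\<beta> * D / 2)" if \<kappa>: "standardized_law \<beta> \<kappa>" for \<kappa>
  proof -
    note L = standardized_lawD[OF \<kappa>]
    interpret \<kappa>: real_distribution \<kappa> by (rule L)
    interpret P: pair_sigma_finite M \<kappa> ..
    interpret Q: pair_sigma_finite M "lborel :: real measure" ..
    have [measurable]: "(\<lambda>(w, t). R w t) \<in> borel_measurable (M \<Otimes>\<^sub>M \<kappa>)"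
      unfolding R_def split_beta' by measurable
    have "(\<integral>\<^sup>+w. (\<integral>\<^sup>+t. R w t \<partial>\<kappa>) \<partial>M) = (\<integral>\<^sup>+t. (\<integral>\<^sup>+w. R w t \<partial>M) \<partial>\<kappa>)"
      by (rule P.Fubini'[symmetric]) simp
    also have "\<dots> \<le> (\<integral>\<^sup>+t. ennreal (\<bar>t\<bar> ^ 3 * (D / 2)) \<partial>\<kappa>)"
    proof (rule nn_integral_mono)
      fix t
      have "(\<integral>\<^sup>+w. R w t \<partial>M) = (\<integral>\<^sup>+s. (\<integral>\<^sup>+w. ennreal (\<bar>t\<bar> ^ 3 / 2 * phase_weight \<theta> (\<lambda>i. Y i w) (t * s)) * indicator {0..1} s \<partial>M) \<partial>lborel)"
        unfolding R_def by (rule Q.Fubini'[symmetric]) measurable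
      also have "\<dots> \<le> (\<integral>\<^sup>+s. ennreal (\<bar>t\<bar> ^ 3 * (D / 2)) * indicator {0..1::real} s \<partial>lborel)"
      proof (rule nn_integral_mono)
        fix s
        have "(\<integral>\<^sup>+w. ennreal (\<bar>t\<bar> ^ 3 / 2 * phase_weight \<theta> (\<lambda>i. Y i w) (t * s)) * indicator {0..1} s \<partial>M)
          = ennreal (\<bar>t\<bar> ^ 3 / 2) * (\<integral>\<^sup>+w. ennreal (phase_weight \<theta> (\<lambda>i. Y i w) (t * s)) \<partial>M) * indicator {0..1} s"
          by (subst ennreal_mult', simp, subst nn_integral_multc, measurable, subst nn_integral_cmult, measurable)
        also have "\<dots> \<le> ennreal (\<bar>t\<bar> ^ 3 / 2) * ennreal D * indicator {0..1} s"
          by (intro mult_right_mono mult_left_mono D) auto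
        also have "\<dots> = ennreal (\<bar>t\<bar> ^ 3 * (D / 2)) * indicator {0..1} s"
          by (simp add: ennreal_mult'[symmetric])
        finally show "(\<integral>\<^sup>+w. ennreal (\<bar>t\<bar> ^ 3 / 2 * phase_weight \<theta> (\<lambda>i. Y i w) (t * s)) * indicator {0..1} s \<partial>M)
          \<le> ennreal (\<bar>t\<bar> ^ 3 * (D / 2)) * indicator {0..1} s" .
      qed
      also have "\<dots> = ennreal (\<bar>t\<bar> ^ 3 * (D / 2))" by (simp add: nn_integral_cmult)
      finally show "(\<integral>\<^sup>+w. R w t \<partial>M) \<le> ennreal (\<bar>t\<bar> ^ 3 * (D / 2))" .
    qed
    also have "\<dots> = ennreal (\<integral>t. \<bar>t\<bar> ^ 3 * (D / 2) \<partial>\<kappa>)"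
      using L(4) \<open>D \<ge> 0\<close> by (intro nn_integral_eq_integral) auto
    also have "\<dots> \<le> ennreal (\<beta> * D / 2)"
      using L(9) \<open>D \<ge> 0\<close> by (intro ennreal_leI) (simp add: mult_right_mono)
    finally show ?thesis .
  qed
  define f where "f \<kappa> w = (\<integral>t. iexp (\<theta> * Y 0 w t) \<partial>\<kappa>)" for \<kappa> :: "real measure" and w
  have fm [measurable]: "f \<kappa> \<in> borel_measurable M" and fi: "integrable M (f \<kappa>)"
    if \<kappa>: "standardized_law \<beta> \<kappa>" for \<kappa>
  proof -
    note L = standardized_lawD[OF \<kappa>]
    interpret \<kappa>: real_distribution \<kappa> by (rule L)
    show m: "f \<kappa> \<in> borel_measurable M" unfolding f_def by measurable
    have "norm (f \<kappa> w) \<le> 1" for w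
    proof -
      have "norm (f \<kappa> w) \<le> (\<integral>t. norm (iexp (\<theta> * Y 0 w t)) \<partial>\<kappa>)" unfolding f_def by (rule integral_norm_bound)
      then show ?thesis using \<kappa>.prob_space by simp
    qed
    then show "integrable M (f \<kappa>)" by (intro integrable_const_bound[of _ 1] m) auto
  qed
  have Rm: "(\<lambda>w. \<integral>\<^sup>+t. R w t \<partial>\<kappa>) \<in> borel_measurable M" if \<kappa>: "standardized_law \<beta> \<kappa>" for \<kappa>
  proof -
    note L = standardized_lawD[OF \<kappa>]
    interpret \<kappa>: real_distribution \<kappa> by (rule L)
    show ?thesis unfolding R_def by measurable
  qed
  have diff: "ennreal (norm (f \<mu> w - f \<nu> w)) \<le> (\<integral>\<^sup>+t. R w t \<partial>\<mu>) + (\<integral>\<^sup>+t. R w t \<partial>\<nu>)"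
    if w: "w \<in> space M" for w
  proof -
    have "\<exists>a b. \<forall>t. ennreal (norm (iexp (\<theta> * Y 0 w t) - (iexp (\<theta> * Y 0 w 0) + of_real t * a + of_real (t\<^sup>2) * b)))
      \<le> R w t"
      unfolding R_def by (rule phase_taylor[of "\<lambda>i. Y i w" \<theta>, OF Y[OF w] cont[OF w]]) blast+
    then obtain a b where ab: "\<And>t. ennreal (norm (iexp (\<theta> * Y 0 w t) - (iexp (\<theta> * Y 0 w 0) + of_real t * a + of_real (t\<^sup>2) * b)))
      \<le> R w t"
      by blast
    let ?c = "iexp (\<theta> * Y 0 w 0) + b"
    have [measurable]: "Y 0 w \<in> borel_measurable borel"
      by (intro borel_measurable_continuous_onI DERIV_continuous_on[where D = "Y 1 w"]) (use Y[OF w, of 0] in auto)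
    have e: "ennreal (norm (f \<kappa> w - ?c)) \<le> (\<integral>\<^sup>+t. R w t \<partial>\<kappa>)" if "standardized_law \<beta> \<kappa>" for \<kappa>
      unfolding f_def by (rule standardized_law_taylor[OF that _ _ ab]) auto
    have "norm (f \<mu> w - f \<nu> w) \<le> norm (f \<mu> w - ?c) + norm (f \<nu> w - ?c)"
      using norm_triangle_ineq4[of "f \<mu> w - ?c" "f \<nu> w - ?c"] by simp
    then have "ennreal (norm (f \<mu> w - f \<nu> w)) \<le> ennreal (norm (f \<mu> w - ?c)) + ennreal (norm (f \<nu> w - ?c))"
      by (simp add: ennreal_plus[symmetric] ennreal_leI del: ennreal_plus)
    also have "\<dots> \<le> (\<integral>\<^sup>+t. R w t \<partial>\<mu>) + (\<integral>\<^sup>+t. R w t \<partial>\<nu>)" by (intro add_mono e law)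
    finally show ?thesis .
  qed
  have "\<beta> \<ge> 0" using standardized_lawD(9)[OF law(1)] 
    by (rule order_trans[rotated]) (auto intro!: integral_nonneg_AE)
  have "ennreal (norm (integral\<^sup>L M (f \<mu>) - integral\<^sup>L M (f \<nu>))) = ennreal (norm (\<integral>w. f \<mu> w - f \<nu> w \<partial>M))"
    using fi law by simp
  also have "\<dots> \<le> (\<integral>\<^sup>+w. ennreal (norm (f \<mu> w - f \<nu> w)) \<partial>M)"
    using fi law by (intro integral_norm_bound_ennreal) auto
  also have "\<dots> \<le> (\<integral>\<^sup>+w. (\<integral>\<^sup>+t. R w t \<partial>\<mu>) + (\<integral>\<^sup>+t. R w t \<partial>\<nu>) \<partial>M)"
    by (rule nn_integral_mono) (rule diff)
  also have "\<dots> = (\<integral>\<^sup>+w. (\<integral>\<^sup>+t. R w t \<partial>\<mu>) \<partial>M) + (\<integral>\<^sup>+w. (\<integral>\<^sup>+t. R w t \<partial>\<nu>) \<partial>M)"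
    by (intro nn_integral_add Rm law)
  also have "\<dots> \<le> ennreal (\<beta> * D / 2) + ennreal (\<beta> * D / 2)"
    by (intro add_mono R_bound law)
  also have "\<dots> = ennreal (\<beta> * D)" using \<open>\<beta> \<ge> 0\<close> \<open>D \<ge> 0\<close> by (simp add: ennreal_plus[symmetric] del: ennreal_plus)
  finally show ?thesis
    using \<open>\<beta> \<ge> 0\<close> \<open>D \<ge> 0\<close> by (simp add: f_def[abs_def] ennreal_le_iff)
qed

section \<open>Anticoncentration of linear forms\<close>

lemma char_PiM_linear:
  assumes law: "\<And>j. real_distribution (\<nu> j)" and J: "finite J"
  shows "(\<integral>w. iexp (\<Sum>j\<in>J. u j * w j) \<partial>PiM J \<nu>) = (\<Prod>j\<in>J. char (\<nu> j) (u j))"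
proof -
  interpret real_distribution "\<nu> j" for j by (rule law)
  interpret product_sigma_finite \<nu> ..
  have "(\<integral>w. iexp (\<Sum>j\<in>J. u j * w j) \<partial>PiM J \<nu>) = (\<integral>w. (\<Prod>j\<in>J. iexp (u j * w j)) \<partial>PiM J \<nu>)"
    by (simp add: sum_distrib_left exp_sum[OF J])
  also have "\<dots> = (\<Prod>j\<in>J. char (\<nu> j) (u j))"
    unfolding char_def by (rule product_integral_prod[OF J]) (auto intro!: integrable_const_bound[of _ 1])
  finally show ?thesis .
qed

lemma gauss_kernel_eq_char: "of_real (gauss_kernel y) = char std_normal_distribution y"
  by (simp add: char_std_normal_distribution gauss_kernel_def)

text \<open>The integrand is at most \<open>2 * \<epsilon>\<close> times the normal density of standard deviation \<open>2 * \<epsilon>\<close>.\<close>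

lemma integral_gauss_kernel_scaled_le:
  assumes "\<epsilon> > 0"
  shows "(\<integral>y. gauss_kernel (y / (2 * \<epsilon>)) \<partial>std_normal_distribution) \<le> 2 * \<epsilon>"
proof -
  have "(\<integral>y. gauss_kernel (y / (2 * \<epsilon>)) \<partial>std_normal_distribution) =
      (\<integral>y. std_normal_density y * gauss_kernel (y / (2 * \<epsilon>)) \<partial>lborel)"
    by (subst integral_density) auto
  also have "\<dots> \<le> (\<integral>y. 2 * \<epsilon> * normal_density 0 (2 * \<epsilon>) y \<partial>lborel)"
  proof (rule integral_mono')
    show "integrable lborel (\<lambda>y. 2 * \<epsilon> * normal_density 0 (2 * \<epsilon>) y)"
      using assms by (intro integrable_mult_right integrable_normal_density) auto
    fix y :: real
    have "std_normal_density y \<le> 1 / sqrt (2 * pi)"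
      by (simp add: std_normal_density_def divide_right_mono)
    then have "std_normal_density y * gauss_kernel (y / (2 * \<epsilon>)) \<le> 1 / sqrt (2 * pi) * gauss_kernel (y / (2 * \<epsilon>))"
      by (intro mult_right_mono) (auto simp: gauss_kernel_def)
    also have "\<dots> = 2 * \<epsilon> * normal_density 0 (2 * \<epsilon>) y"
      using assms real_sqrt_mult[of 4 2] by (simp add: normal_density_def gauss_kernel_def real_sqrt_mult
          power_mult_distrib power_divide field_simps)
    finally show "std_normal_density y * gauss_kernel (y / (2 * \<epsilon>)) \<le> 2 * \<epsilon> * normal_density 0 (2 * \<epsilon>) y" .
  qed (use assms in auto)
  also have "\<dots> = 2 * \<epsilon>" using assms by simp
  finally show ?thesis .
qed

text \<open>The probability that several linear forms \<open>S k = (\<Sum>j. V j k * w j)\<close> are simultaneously close to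
  prescribed points is of the order of the product of the widths, up to the error \<open>card I / A\<^sup>2\<close>.
  The kernel is the characteristic function of a normal variable \<open>N k\<close>, so Fubini expresses the
  expectation through the product of the characteristic functions of the \<open>w j\<close> at
  \<open>u N j = (\<Sum>k. N k * V j k / \<epsilon>)\<close>. When all \<open>\<bar>N k\<bar> \<le> A\<close>, these arguments are at most \<open>c\<close> and the product is
  at most \<open>exp (- (\<Sum>k. (N k)\<^sup>2) / (8 * \<epsilon>\<^sup>2))\<close>, by \<open>quad\<close>; its mean over \<open>N\<close>
  factorises. The other \<open>N\<close> are handled by Chebyshev's inequality.\<close>

lemma anticoncentration:
  fixes V :: "nat \<Rightarrow> nat \<Rightarrow> real"
  assumes law: "\<And>j. standardized_law \<beta> (\<nu> j)" and I: "finite I" and J: "finite J"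
    and quad: "\<And>u. (\<Sum>k\<in>I. (u k)\<^sup>2) / 2 \<le> (\<Sum>j\<in>J. (\<Sum>k\<in>I. u k * V j k)\<^sup>2)"
    and V: "\<And>j k. j \<in> J \<Longrightarrow> k \<in> I \<Longrightarrow> \<bar>V j k\<bar> \<le> \<eta>"
    and \<epsilon>: "\<epsilon> > 0" and A: "A > 0"
    and c: "real (card I) * (A / \<epsilon> * \<eta>) \<le> c" "c \<le> 1" "c * \<beta> \<le> 3 / 2"
  shows "(\<integral>w. (\<Prod>k\<in>I. gauss_kernel (((\<Sum>j\<in>J. V j k * w j) - a k) / \<epsilon>)) \<partial>PiM J \<nu>)
    \<le> (2 * \<epsilon>) ^ card I + real (card I) / A\<^sup>2"
proof -
  note L = standardized_lawD[OF law]
  define \<gamma> where "\<gamma> = std_normal_distribution"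
  interpret \<nu>: real_distribution "\<nu> j" for j by (rule L)
  interpret \<gamma>: real_distribution \<gamma> unfolding \<gamma>_def by (rule real_dist_normal_dist)
  interpret PJ: finite_product_prob_space \<nu> J by standard (rule J)
  interpret PI: finite_product_prob_space "\<lambda>_. \<gamma>" I by standard (rule I)
  interpret PP: pair_prob_space "PiM J \<nu>" "PiM I (\<lambda>_. \<gamma>)" ..
  let ?S = "\<lambda>w k. \<Sum>j\<in>J. V j k * w j"
  let ?h = "\<lambda>w N. \<Prod>k\<in>I. iexp (N k * ((?S w k - a k) / \<epsilon>))"
  define u where "u N j = (\<Sum>k\<in>I. N k / \<epsilon> * V j k)" for N j
  have nh: "norm (?h w N) = 1" for w N by (simp add: prod_norm[symmetric])
  have K: "of_real (\<Prod>k\<in>I. gauss_kernel ((?S w k - a k) / \<epsilon>)) = (\<integral>N. ?h w N \<partial>PiM I (\<lambda>_. \<gamma>))" for w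
  proof -
    have "(\<integral>N. ?h w N \<partial>PiM I (\<lambda>_. \<gamma>)) = (\<Prod>k\<in>I. (\<integral>N. iexp (N * ((?S w k - a k) / \<epsilon>)) \<partial>\<gamma>))"
      by (rule PI.product_integral_prod[OF I]) (auto intro!: \<gamma>.integrable_const_bound[of _ 1])
    also have "\<dots> = (\<Prod>k\<in>I. of_real (gauss_kernel ((?S w k - a k) / \<epsilon>)))"
      unfolding gauss_kernel_eq_char char_def \<gamma>_def by (simp add: mult.commute)
    finally show ?thesis by simp
  qed
  have hm [measurable]: "(\<lambda>(w, N). ?h w N) \<in> borel_measurable (PiM J \<nu> \<Otimes>\<^sub>M PiM I (\<lambda>_. \<gamma>))"
    unfolding split_beta' by measurable
  have inth: "integrable (PiM J \<nu> \<Otimes>\<^sub>M PiM I (\<lambda>_. \<gamma>)) (\<lambda>(w, N). ?h w N)"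
  proof (rule PP.integrable_const_bound[OF _ hm])
    show "AE p in PiM J \<nu> \<Otimes>\<^sub>M PiM I (\<lambda>_. \<gamma>). norm (case p of (w, N) \<Rightarrow> ?h w N) \<le> 1"
      by (intro always_eventually allI) (simp only: split_beta' nh order_refl)
  qed
  have inner: "norm (\<integral>w. ?h w N \<partial>PiM J \<nu>) = (\<Prod>j\<in>J. norm (char (\<nu> j) (u N j)))" for N
  proof -
    have "?h w N = iexp (- (\<Sum>k\<in>I. N k * a k / \<epsilon>)) * iexp (\<Sum>j\<in>J. u N j * w j)" for w
    proof -
      have "(\<Sum>j\<in>J. u N j * w j) = (\<Sum>j\<in>J. \<Sum>k\<in>I. N k / \<epsilon> * (V j k * w j))"
        by (simp add: u_def sum_distrib_right mult.assoc)
      also have "\<dots> = (\<Sum>k\<in>I. N k / \<epsilon> * ?S w k)"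
        by (subst sum.swap) (simp add: sum_distrib_left)
      finally have "(\<Sum>k\<in>I. N k * ((?S w k - a k) / \<epsilon>)) = - (\<Sum>k\<in>I. N k * a k / \<epsilon>) + (\<Sum>j\<in>J. u N j * w j)"
        by (simp add: sum_negf[symmetric] sum.distrib[symmetric] diff_divide_distrib right_diff_distrib)
      moreover have "?h w N = iexp (\<Sum>k\<in>I. N k * ((?S w k - a k) / \<epsilon>))"
        by (simp only: exp_sum[OF I, symmetric] of_real_sum sum_distrib_left)
      ultimately show ?thesis by (simp only: of_real_add distrib_left exp_add)
    qed
    then have "(\<integral>w. ?h w N \<partial>PiM J \<nu>) = iexp (- (\<Sum>k\<in>I. N k * a k / \<epsilon>)) * (\<Prod>j\<in>J. char (\<nu> j) (u N j))"
      by (simp only: char_PiM_linear[OF L(1) J, symmetric] integral_mult_right_zero)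
    then show ?thesis by (simp add: norm_mult prod_norm[symmetric])
  qed
  (* the first summand serves for small frequencies, the second one, at least 1 otherwise, for large ones *)
  let ?b = "\<lambda>N. (\<Prod>k\<in>I. gauss_kernel (N k / (2 * \<epsilon>))) + (\<Sum>k\<in>I. (N k)\<^sup>2 / A\<^sup>2)"
  have bound: "(\<Prod>j\<in>J. norm (char (\<nu> j) (u N j))) \<le> ?b N" for N
  proof (cases "\<forall>k\<in>I. \<bar>N k\<bar> \<le> A")
    case True
    have small: "norm (char (\<nu> j) (u N j)) \<le> exp (- (u N j)\<^sup>2 / 4)" if j: "j \<in> J" for j
    proof -
      have "\<bar>u N j\<bar> \<le> (\<Sum>k\<in>I. \<bar>N k / \<epsilon> * V j k\<bar>)" unfolding u_def by (rule sum_abs)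
      also have "\<dots> \<le> (\<Sum>k\<in>I. A / \<epsilon> * \<eta>)"
        unfolding abs_mult using True V j \<epsilon> A by (intro sum_mono mult_mono) (auto simp: divide_right_mono)
      also have "\<dots> \<le> c" using c by simp
      finally have uc: "\<bar>u N j\<bar> \<le> c" .
      have "\<beta> \<ge> 0"
        using L(9)[of j] by (rule order_trans[rotated]) (auto intro!: integral_nonneg_AE)
      then have "\<bar>u N j\<bar> * \<beta> \<le> c * \<beta>" using uc by (intro mult_right_mono)
      with uc c show ?thesis by (intro norm_char_standardized_le[OF law]) auto
    qed
    have "(\<Prod>j\<in>J. norm (char (\<nu> j) (u N j))) \<le> (\<Prod>j\<in>J. exp (- (u N j)\<^sup>2 / 4))"
      by (intro prod_mono conjI norm_ge_zero small)
    also have "\<dots> = exp (- (\<Sum>j\<in>J. (u N j)\<^sup>2) / 4)"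
      by (simp add: exp_sum[OF J, symmetric] sum_negf sum_divide_distrib)
    also have "\<dots> \<le> exp (- ((\<Sum>k\<in>I. (N k / \<epsilon>)\<^sup>2) / 2) / 4)"
      using quad[of "\<lambda>k. N k / \<epsilon>"] by (simp add: u_def)
    also have "\<dots> = (\<Prod>k\<in>I. gauss_kernel (N k / (2 * \<epsilon>)))"
      unfolding gauss_kernel_def exp_sum[OF I, symmetric]
      by (simp add: sum_negf sum_divide_distrib power_divide power_mult_distrib)
    finally show ?thesis by (simp add: add_increasing2 sum_nonneg)
  next
    case False
    then obtain k where k: "k \<in> I" "\<bar>N k\<bar> > A" by auto
    have "(\<Prod>j\<in>J. norm (char (\<nu> j) (u N j))) \<le> 1"
      by (intro prod_le_1) (auto intro: \<nu>.cmod_char_le_1)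
    also have "1 \<le> (N k)\<^sup>2 / A\<^sup>2"
      using k A power_mono[of A "\<bar>N k\<bar>" 2] by simp
    also have "\<dots> \<le> (\<Sum>k\<in>I. (N k)\<^sup>2 / A\<^sup>2)"
      using k I by (intro member_le_sum) auto
    also have "\<dots> \<le> ?b N"
      by (simp add: prod_nonneg gauss_kernel_pos less_imp_le)
    finally show ?thesis .
  qed
  have intN: "integrable (PiM I (\<lambda>_. \<gamma>)) (\<lambda>N. (N k)\<^sup>2)" "(\<integral>N. (N k)\<^sup>2 \<partial>PiM I (\<lambda>_. \<gamma>)) = 1" if "k \<in> I" for k
  proof -
    have d: "distr (PiM I (\<lambda>_. \<gamma>)) \<gamma> (\<lambda>N. N k) = \<gamma>"
      using that by (intro PI.PiM_component) 
    note G = standardized_lawD[OF standardized_law_std_normal, folded \<gamma>_def]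
    have [measurable]: "(\<lambda>N. N k) \<in> measurable (PiM I (\<lambda>_. \<gamma>)) \<gamma>" using that by measurable
    have "integrable (distr (PiM I (\<lambda>_. \<gamma>)) \<gamma> (\<lambda>N. N k)) (\<lambda>y. y\<^sup>2)" unfolding d by (rule G)
    then show "integrable (PiM I (\<lambda>_. \<gamma>)) (\<lambda>N. (N k)\<^sup>2)"
      by (subst (asm) integrable_distr_eq) auto
    have "(\<integral>y. y\<^sup>2 \<partial>distr (PiM I (\<lambda>_. \<gamma>)) \<gamma> (\<lambda>N. N k)) = 1" unfolding d by (rule G)
    then show "(\<integral>N. (N k)\<^sup>2 \<partial>PiM I (\<lambda>_. \<gamma>)) = 1"
      by (subst (asm) integral_distr) auto
  qed
  have ik: "integrable \<gamma> (\<lambda>y. gauss_kernel (y / (2 * \<epsilon>)))"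
    by (rule \<gamma>.integrable_const_bound[of _ 1]) (auto simp: gauss_kernel_pos less_imp_le gauss_kernel_le_1)
  have intK: "integrable (PiM I (\<lambda>_. \<gamma>)) (\<lambda>N. \<Prod>k\<in>I. gauss_kernel (N k / (2 * \<epsilon>)))"
    by (rule PI.product_integrable_prod[OF I ik])
  have intb: "integrable (PiM I (\<lambda>_. \<gamma>)) ?b"
    using intN intK by auto
  have "(\<integral>w. (\<Prod>k\<in>I. gauss_kernel ((?S w k - a k) / \<epsilon>)) \<partial>PiM J \<nu>)
    = norm (\<integral>w. complex_of_real (\<Prod>k\<in>I. gauss_kernel ((?S w k - a k) / \<epsilon>)) \<partial>PiM J \<nu>)"
    unfolding integral_complex_of_real norm_of_real
    by (intro abs_of_nonneg[symmetric] integral_nonneg_AE) (auto intro!: prod_nonneg simp: gauss_kernel_pos less_imp_le)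
  also have "\<dots> = norm (\<integral>N. (\<integral>w. ?h w N \<partial>PiM J \<nu>) \<partial>PiM I (\<lambda>_. \<gamma>))"
    unfolding K by (subst PP.Fubini_integral[OF inth]) simp
  also have "\<dots> \<le> (\<integral>N. norm (\<integral>w. ?h w N \<partial>PiM J \<nu>) \<partial>PiM I (\<lambda>_. \<gamma>))"
    by (rule integral_norm_bound)
  also have "\<dots> \<le> (\<integral>N. ?b N \<partial>PiM I (\<lambda>_. \<gamma>))"
  proof (rule integral_mono'[OF intb])
    fix N
    show "norm (\<integral>w. ?h w N \<partial>PiM J \<nu>) \<le> ?b N" unfolding inner by (rule bound)
    show "0 \<le> ?b N" by (intro add_nonneg_nonneg prod_nonneg sum_nonneg) (auto simp: gauss_kernel_pos less_imp_le)
  qed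
  also have "\<dots> = (\<integral>N. (\<Prod>k\<in>I. gauss_kernel (N k / (2 * \<epsilon>))) \<partial>PiM I (\<lambda>_. \<gamma>)) + (\<Sum>k\<in>I. 1 / A\<^sup>2)"
    using intN intK by (subst Bochner_Integration.integral_add) auto
  also have "(\<integral>N. (\<Prod>k\<in>I. gauss_kernel (N k / (2 * \<epsilon>))) \<partial>PiM I (\<lambda>_. \<gamma>)) =
      (\<integral>y. gauss_kernel (y / (2 * \<epsilon>)) \<partial>\<gamma>) ^ card I"
    by (subst PI.product_integral_prod[OF I ik]) simp
  also have "\<dots> \<le> (2 * \<epsilon>) ^ card I"
    unfolding \<gamma>_def using integral_gauss_kernel_scaled_le[OF \<epsilon>]
    by (intro power_mono integral_nonneg_AE) (auto simp: gauss_kernel_pos less_imp_le)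
  finally show ?thesis by simp
qed

section \<open>The cosine vectors\<close>

definition cos_weight :: "nat \<Rightarrow> nat \<Rightarrow> nat \<Rightarrow> real" where
  "cos_weight n j k = sqrt (2 / real n) * cos (2 * pi * real j * real k / real n)"

text \<open>After multiplication by \<open>2 * sin h\<close> the sum telescopes to a difference of two values of \<open>sin\<close> whose
  arguments differ by \<open>2 * pi * m\<close>.\<close>

lemma sum_cos_multiples_eq_0:
  assumes "0 < m" "m < n"
  shows "(\<Sum>j=1..n. cos (2 * pi * real j * real m / real n)) = 0"
proof -
  define h where "h = pi * real m / real n"
  have h: "0 < h" "h < pi" using assms by (auto simp: h_def field_simps)
  have tel: "2 * sin h * cos (2 * real j * h) = sin ((2 * real (Suc j) - 1) * h) - sin ((2 * real j - 1) * h)" for j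
  proof -
    have "(2 * real (Suc j) - 1) * h = 2 * real j * h + h" "(2 * real j - 1) * h = 2 * real j * h - h"
      by (simp_all add: algebra_simps)
    then show ?thesis by (simp only: sin_add sin_diff) simp
  qed
  have "2 * sin h * (\<Sum>j=1..n. cos (2 * real j * h)) =
      (\<Sum>j=1..n. sin ((2 * real (Suc j) - 1) * h) - sin ((2 * real j - 1) * h))"
    unfolding sum_distrib_left tel ..
  also have "\<dots> = sin ((2 * real (Suc n) - 1) * h) - sin ((2 * real 1 - 1) * h)"
    by (rule sum_Suc_diff) (use assms in simp)
  also have "(2 * real (Suc n) - 1) * h = h + 2 * pi * real m"
    using assms by (simp add: h_def field_simps)
  also have "sin \<dots> - sin ((2 * real 1 - 1) * h) = 0"
    using sin.plus_of_nat[of h m] by (simp add: mult_ac)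
  finally have "(\<Sum>j=1..n. cos (2 * real j * h)) = 0"
    using sin_gt_zero[OF h] by simp
  then show ?thesis by (simp add: h_def mult_ac)
qed

lemma cos_weight_orthonormal:
  assumes k: "0 < k" "2 * k < n" and l: "0 < l" "2 * l < n"
  shows "(\<Sum>j=1..n. cos_weight n j k * cos_weight n j l) = (if k = l then 1 else 0)"
proof -
  have n: "n > 0" using k by simp
  have gen: "(\<Sum>j=1..n. cos_weight n j k * cos_weight n j l) = (if k = l then 1 else 0)"
    if kl: "k \<le> l" and k: "0 < k" "2 * k < n" and l: "0 < l" "2 * l < n" for k l
  proof -
    let ?c = "\<lambda>m j. cos (2 * pi * real j * real m / real n)"
    have "cos_weight n j k * cos_weight n j l = (?c (l - k) j + ?c (l + k) j) / real n" for j
    proof -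
      have "2 * pi * real j * real (l - k) / real n = 2 * pi * real j * real l / real n - 2 * pi * real j * real k / real n"
        "2 * pi * real j * real (l + k) / real n = 2 * pi * real j * real l / real n + 2 * pi * real j * real k / real n"
        using kl by (simp_all add: of_nat_diff diff_divide_distrib add_divide_distrib algebra_simps)
      then have "?c (l - k) j + ?c (l + k) j = 2 * (?c l j * ?c k j)"
        by (simp add: cos_add cos_diff)
      moreover have "cos_weight n j k * cos_weight n j l = (sqrt (2 / real n) * sqrt (2 / real n)) * (?c l j * ?c k j)"
        unfolding cos_weight_def by (simp only: mult_ac)
      moreover have "sqrt (2 / real n) * sqrt (2 / real n) = 2 / real n" by simp
      ultimately show ?thesis by simp
    qed
    then have "(\<Sum>j=1..n. cos_weight n j k * cos_weight n j l) =
        ((\<Sum>j=1..n. ?c (l - k) j) + (\<Sum>j=1..n. ?c (l + k) j)) / real n"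
      by (simp only: sum_divide_distrib[symmetric] sum.distrib)
    also have "(\<Sum>j=1..n. ?c (l + k) j) = 0"
      using k l by (intro sum_cos_multiples_eq_0) auto
    also have "(\<Sum>j=1..n. ?c (l - k) j) = (if k = l then real n else 0)"
    proof (cases "k = l")
      case False
      then have "(\<Sum>j=1..n. ?c (l - k) j) = 0"
        using k l kl by (intro sum_cos_multiples_eq_0) auto
      then show ?thesis using False by simp
    qed simp
    finally show ?thesis using n by simp
  qed
  show ?thesis
    using gen[OF _ k l] gen[OF _ l k] by (cases "k \<le> l") (auto simp: mult.commute)
qed

lemma abs_cos_weight_le: "\<bar>cos_weight n j k\<bar> \<le> sqrt (2 / real n)"
  using mult_left_mono[OF abs_cos_le_one, of "sqrt (2 / real n)"] by (simp add: cos_weight_def abs_mult)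

lemma cos_weight_isometry:
  assumes I: "finite I" "\<And>k. k \<in> I \<Longrightarrow> 0 < k \<and> 2 * k < n"
  shows "(\<Sum>j=1..n. (\<Sum>k\<in>I. u k * cos_weight n j k)\<^sup>2) = (\<Sum>k\<in>I. (u k)\<^sup>2)"
proof -
  have "(\<Sum>j=1..n. (\<Sum>k\<in>I. u k * cos_weight n j k)\<^sup>2) =
      (\<Sum>j=1..n. \<Sum>k\<in>I. \<Sum>l\<in>I. u k * u l * (cos_weight n j k * cos_weight n j l))"
    by (simp add: power2_eq_square sum_product mult_ac)
  also have "\<dots> = (\<Sum>k\<in>I. \<Sum>l\<in>I. u k * u l * (\<Sum>j=1..n. cos_weight n j k * cos_weight n j l))"
    by (subst sum.swap, rule sum.cong[OF refl], subst sum.swap) (simp add: sum_distrib_left)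
  also have "\<dots> = (\<Sum>k\<in>I. \<Sum>l\<in>I. if k = l then u k * u l else 0)"
  proof (intro sum.cong refl)
    fix k l assume "k \<in> I" "l \<in> I"
    then have "(\<Sum>j=1..n. cos_weight n j k * cos_weight n j l) = (if k = l then 1 else 0)"
      using I(2) by (intro cos_weight_orthonormal) auto
    then show "u k * u l * (\<Sum>j=1..n. cos_weight n j k * cos_weight n j l) = (if k = l then u k * u l else 0)"
      by simp
  qed
  also have "\<dots> = (\<Sum>k\<in>I. (u k)\<^sup>2)"
    using I by (simp add: power2_eq_square)
  finally show ?thesis .
qed

text \<open>Leaving out one variable removes at most the fraction \<open>2 * card I / n\<close> of the squared norm, by the Cauchy-Schwarz
  inequality. This is what remains while the law of variable \<open>m\<close> is being exchanged.\<close>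

lemma cos_weight_almost_isometry:
  assumes I: "finite I" "\<And>k. k \<in> I \<Longrightarrow> 0 < k \<and> 2 * k < n"
    and J: "{1..n} - {m} \<subseteq> J" "J \<subseteq> {1..n}" and n: "4 * card I \<le> n"
  shows "(\<Sum>k\<in>I. (u k)\<^sup>2) / 2 \<le> (\<Sum>j\<in>J. (\<Sum>k\<in>I. u k * cos_weight n j k)\<^sup>2)"
proof (cases "n = 0")
  case False
  let ?q = "\<lambda>j. (\<Sum>k\<in>I. u k * cos_weight n j k)\<^sup>2"
  have "?q m \<le> real (card I) * (\<Sum>k\<in>I. (u k * cos_weight n m k)\<^sup>2)"
    using sum_squared_le_sum_of_squares[of "\<lambda>k. u k * cos_weight n m k" I] by (simp add: mult.commute)
  also have "\<dots> \<le> real (card I) * (\<Sum>k\<in>I. (u k)\<^sup>2 * (2 / real n))"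
  proof (intro mult_left_mono sum_mono)
    fix k
    have "(cos_weight n m k)\<^sup>2 \<le> 2 / real n"
      using power_mono[OF abs_cos_weight_le[of n m k], of 2] by simp
    then show "(u k * cos_weight n m k)\<^sup>2 \<le> (u k)\<^sup>2 * (2 / real n)"
      unfolding power_mult_distrib by (intro mult_left_mono) auto
  qed auto
  also have "\<dots> = (2 * real (card I) / real n) * (\<Sum>k\<in>I. (u k)\<^sup>2)"
    by (simp add: sum_distrib_left sum_divide_distrib mult_ac)
  also have "\<dots> \<le> 1 / 2 * (\<Sum>k\<in>I. (u k)\<^sup>2)"
  proof (rule mult_right_mono)
    have "4 * real (card I) \<le> real n" using n by (metis of_nat_le_iff of_nat_mult of_nat_numeral)
    then show "2 * real (card I) / real n \<le> 1 / 2" using False by (simp add: field_simps)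
  qed (auto intro: sum_nonneg)
  finally have m: "?q m \<le> (\<Sum>k\<in>I. (u k)\<^sup>2) / 2" by simp
  have "(\<Sum>k\<in>I. (u k)\<^sup>2) = (\<Sum>j=1..n. ?q j)" using cos_weight_isometry[OF I] by simp
  also have "\<dots> \<le> (\<Sum>j\<in>insert m J. ?q j)"
    using J by (intro sum_mono2) (auto intro: finite_subset)
  also have "\<dots> \<le> ?q m + (\<Sum>j\<in>J. ?q j)"
    using J finite_subset[of J "{1..n}"] by (cases "m \<in> J") (auto simp: insert_absorb)
  finally show ?thesis using m by simp
next
  case True
  then have "I = {}" using I by auto
  then show ?thesis by simp
qed

section \<open>Independence from the joint characteristic function\<close>

lemma (in prob_space) normalized_density:
  assumes [measurable]: "h \<in> borel_measurable M" and pos: "\<And>\<omega>. 0 \<le> h \<omega>"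
    and int: "integrable M h" and c: "expectation h = c" "0 < c"
  shows "prob_space (density M (\<lambda>\<omega>. ennreal (h \<omega> / c)))"
    and "\<And>f :: 'a \<Rightarrow> 'b::{banach, second_countable_topology}. f \<in> borel_measurable M \<Longrightarrow>
      (\<integral>\<omega>. f \<omega> \<partial>density M (\<lambda>\<omega>. ennreal (h \<omega> / c))) = (1 / c) *\<^sub>R (\<integral>\<omega>. h \<omega> *\<^sub>R f \<omega> \<partial>M)"
proof -
  have "(\<integral>\<^sup>+\<omega>. ennreal (h \<omega> / c) \<partial>M) = ennreal (\<integral>\<omega>. h \<omega> / c \<partial>M)"
    using int pos c by (intro nn_integral_eq_integral) auto
  also have "\<dots> = 1" using c by simp
  finally show "prob_space (density M (\<lambda>\<omega>. ennreal (h \<omega> / c)))"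
    by (intro prob_spaceI) (simp add: emeasure_density cong: nn_integral_cong)
  fix f :: "'a \<Rightarrow> 'b" assume [measurable]: "f \<in> borel_measurable M"
  have "(\<integral>\<omega>. f \<omega> \<partial>density M (\<lambda>\<omega>. ennreal (h \<omega> / c))) = (\<integral>\<omega>. (h \<omega> / c) *\<^sub>R f \<omega> \<partial>M)"
    using pos c by (intro integral_density) auto
  also have "\<dots> = (\<integral>\<omega>. (1 / c) *\<^sub>R (h \<omega> *\<^sub>R f \<omega>) \<partial>M)" by simp
  also have "\<dots> = (1 / c) *\<^sub>R (\<integral>\<omega>. h \<omega> *\<^sub>R f \<omega> \<partial>M)" by (rule integral_scaleR_right)
  finally show "(\<integral>\<omega>. f \<omega> \<partial>density M (\<lambda>\<omega>. ennreal (h \<omega> / c))) = (1 / c) *\<^sub>R (\<integral>\<omega>. h \<omega> *\<^sub>R f \<omega> \<partial>M)" .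
qed

text \<open>A family with the joint characteristic function of independent standard normal variables is
  independent and standard normal. The uniqueness theorem for one variable is lifted by induction on
  the index set. To split off \<open>Z m\<close>, the probability measure is tilted by the density \<open>1 + cos (s * Z m)\<close> or
  \<open>1 + sin (s * Z m)\<close>, suitably normalised: the other variables keep their joint characteristic
  function, hence by induction their joint law. This determines the mean of
  \<open>g * exp (i * s * Z m)\<close>, where \<open>g\<close> is the indicator that the other variables lie in given sets; so
  \<open>Z m\<close> is standard normal under the measure with density proportional to \<open>g\<close>. The tilting
  functions have to be nonnegative, whence the constant 1.\<close>

lemma independent_std_normal_of_joint_char:
  fixes Z :: "'i \<Rightarrow> 'a \<Rightarrow> real"
  assumes "finite I" "prob_space M" "\<And>k. k \<in> I \<Longrightarrow> Z k \<in> borel_measurable M"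
    and "\<And>t. (\<integral>\<omega>. iexp (\<Sum>k\<in>I. t k * Z k \<omega>) \<partial>M) = exp (- (\<Sum>k\<in>I. (t k)\<^sup>2) / 2)"
    and "\<And>k. k \<in> I \<Longrightarrow> A k \<in> sets borel"
  shows "(\<integral>\<omega>. (\<Prod>k\<in>I. indicat_real (A k) (Z k \<omega>)) \<partial>M) = (\<Prod>k\<in>I. measure std_normal_distribution (A k))"
  using assms
proof (induction I arbitrary: M rule: finite_induct)
  case empty
  then interpret prob_space M by simp
  show ?case by (simp add: prob_space)
next
  case (insert m I)
  interpret prob_space M by (rule insert.prems)
  have Zm [measurable]: "Z k \<in> borel_measurable M" if "k \<in> insert m I" for k using insert.prems that by simp
  have Zm' [measurable]: "Z m \<in> borel_measurable M" by simp
  have A [measurable]: "A k \<in> sets borel" if "k \<in> insert m I" for k using insert.prems that by simp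
  have [measurable]: "A m \<in> sets borel" by simp
  define T where "T t \<omega> = (\<Sum>k\<in>I. t k * Z k \<omega>)" for t \<omega>
  have [measurable]: "T t \<in> borel_measurable M" for t unfolding T_def by simp
  define q where "q t = exp (- (\<Sum>k\<in>I. (t k)\<^sup>2) / 2)" for t :: "'i \<Rightarrow> real"
  have joint: "(\<integral>\<omega>. iexp (T t \<omega> + s * Z m \<omega>) \<partial>M) = of_real (q t * exp (- s\<^sup>2 / 2))" for t s
  proof -
    have "(\<Sum>k\<in>insert m I. (t(m := s)) k * Z k \<omega>) = T t \<omega> + s * Z m \<omega>" for \<omega>
      unfolding T_def using insert.hyps by (simp add: add.commute) (intro sum.cong refl, auto)
    moreover have "(\<Sum>k\<in>insert m I. ((t(m := s)) k)\<^sup>2) = (\<Sum>k\<in>I. (t k)\<^sup>2) + s\<^sup>2"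
      using insert.hyps by (simp add: add.commute) (intro sum.cong refl, auto)
    ultimately show ?thesis
      using insert.prems(3)[of "t(m := s)"] by (simp add: q_def exp_add[symmetric] add_divide_distrib)
  qed
  define g where "g \<omega> = (\<Prod>k\<in>I. indicat_real (A k) (Z k \<omega>))" for \<omega>
  define p where "p = (\<Prod>k\<in>I. measure std_normal_distribution (A k))"
  have g01: "0 \<le> g \<omega>" "g \<omega> \<le> 1" for \<omega>
    unfolding g_def by (auto intro!: prod_nonneg prod_le_1)
  have [measurable]: "g \<in> borel_measurable M" unfolding g_def by measurable
  have tilt: "(\<integral>\<omega>. h \<omega> * g \<omega> \<partial>M) = c * p"
    if [measurable]: "h \<in> borel_measurable M" and h: "\<And>\<omega>. 0 \<le> h \<omega>" "\<And>\<omega>. h \<omega> \<le> 2" and c: "c > 0"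
      and ch: "\<And>t. (\<integral>\<omega>. of_real (h \<omega>) * iexp (T t \<omega>) \<partial>M) = of_real (c * q t)" for h c
  proof -
    have hi: "integrable M h" using h by (intro integrable_const_bound[of _ 2]) auto
    have "complex_of_real (expectation h) = of_real c"
      using ch[of "\<lambda>_. 0"] by (simp add: T_def q_def)
    then have hc: "expectation h = c" by simp
    let ?D = "density M (\<lambda>\<omega>. ennreal (h \<omega> / c))"
    note nd = normalized_density[OF that(1) h(1) hi hc c]
    have "(\<integral>\<omega>. (\<Prod>k\<in>I. indicat_real (A k) (Z k \<omega>)) \<partial>?D) = p"
      unfolding p_def
    proof (rule insert.IH[OF nd(1)])
      show "(\<integral>\<omega>. iexp (\<Sum>k\<in>I. t k * Z k \<omega>) \<partial>?D) = exp (- (\<Sum>k\<in>I. (t k)\<^sup>2) / 2)" for t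
      proof -
        have "(\<integral>\<omega>. iexp (T t \<omega>) \<partial>?D) = (1 / c) *\<^sub>R (\<integral>\<omega>. h \<omega> *\<^sub>R iexp (T t \<omega>) \<partial>M)"
          by (rule nd(2)) measurable
        then have "(\<integral>\<omega>. iexp (T t \<omega>) \<partial>?D) = of_real (q t)"
          using ch[of t] c by (simp add: scaleR_conv_of_real)
        then show ?thesis by (simp add: T_def q_def)
      qed
    qed (use Zm A in auto)
    moreover have "(\<integral>\<omega>. g \<omega> \<partial>?D) = (1 / c) *\<^sub>R (\<integral>\<omega>. h \<omega> *\<^sub>R g \<omega> \<partial>M)"
      by (rule nd(2)) measurable
    ultimately show ?thesis using c by (simp add: g_def[abs_def] field_simps)
  qed
  have intb: "integrable M f" if "f \<in> borel_measurable M" "\<And>\<omega>. norm (f \<omega>) \<le> 2" for f :: "'a \<Rightarrow> complex"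
    using that by (intro integrable_const_bound[of _ 2]) auto
  have intr: "integrable M f" if "f \<in> borel_measurable M" "\<And>\<omega>. \<bar>f \<omega>\<bar> \<le> 2" for f :: "'a \<Rightarrow> real"
    using that by (intro integrable_const_bound[of _ 2]) auto
  have g1: "(\<integral>\<omega>. g \<omega> \<partial>M) = p"
    using tilt[of "\<lambda>_. 1" 1] joint[of _ 0] by simp
  have E1: "(\<integral>\<omega>. iexp (T t \<omega>) \<partial>M) = of_real (q t)" for t using joint[of t 0] by simp
  have Ep: "(\<integral>\<omega>. iexp (T t \<omega>) * iexp (s * Z m \<omega>) \<partial>M) = of_real (q t * exp (- s\<^sup>2 / 2))" for t s
    using joint[of t s] by (simp add: distrib_left exp_add)
  have i1: "integrable M (\<lambda>\<omega>. iexp (T t \<omega>))" for t by (rule intb) auto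
  have i2: "integrable M (\<lambda>\<omega>. iexp (T t \<omega>) * iexp (s * Z m \<omega>))" for t s
    by (rule intb) (auto simp: norm_mult)
  have gcos: "(\<integral>\<omega>. cos (s * Z m \<omega>) * g \<omega> \<partial>M) = exp (- s\<^sup>2 / 2) * p" for s
  proof -
    let ?h = "\<lambda>\<omega>. 1 + cos (s * Z m \<omega>)"
    have "(\<integral>\<omega>. ?h \<omega> * g \<omega> \<partial>M) = (1 + exp (- s\<^sup>2 / 2)) * p"
    proof (rule tilt)
      show "0 \<le> ?h \<omega>" "?h \<omega> \<le> 2" for \<omega> using cos_ge_minus_one[of "s * Z m \<omega>"] cos_le_one[of "s * Z m \<omega>"] by linarith+
      show "0 < 1 + exp (- s\<^sup>2 / 2)" by (simp add: add_pos_pos)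
      fix t
      have "of_real (?h \<omega>) * iexp (T t \<omega>) = iexp (T t \<omega>) + (1/2) * (iexp (T t \<omega>) * iexp (s * Z m \<omega>))
         + (1/2) * (iexp (T t \<omega>) * iexp (- s * Z m \<omega>))" for \<omega>
        by (simp add: cos_of_real[symmetric] cos_exp_eq algebra_simps)
      then have "(\<integral>\<omega>. of_real (?h \<omega>) * iexp (T t \<omega>) \<partial>M) = of_real (q t) + (1/2) * of_real (q t * exp (- s\<^sup>2 / 2))
         + (1/2) * of_real (q t * exp (- (- s)\<^sup>2 / 2))"
        using E1[of t] Ep[of t s] Ep[of t "-s"] i1[of t] i2[of t s] i2[of t "-s"]
        by (simp only: Bochner_Integration.integral_add Bochner_Integration.integrable_add
            integral_mult_right_zero integrable_mult_right)
      then show "(\<integral>\<omega>. of_real (?h \<omega>) * iexp (T t \<omega>) \<partial>M) = of_real ((1 + exp (- s\<^sup>2 / 2)) * q t)"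
        by (simp add: algebra_simps)
    qed measurable
    moreover have "(\<integral>\<omega>. ?h \<omega> * g \<omega> \<partial>M) = (\<integral>\<omega>. g \<omega> \<partial>M) + (\<integral>\<omega>. cos (s * Z m \<omega>) * g \<omega> \<partial>M)"
    proof (subst Bochner_Integration.integral_add[symmetric])
      show "integrable M g" using g01 by (intro intr) (auto simp: order_trans[of _ 1])
      have "\<bar>cos (s * Z m \<omega>) * g \<omega>\<bar> \<le> 2" for \<omega>
        unfolding abs_mult using mult_mono[OF abs_cos_le_one[of "s * Z m \<omega>"], of "\<bar>g \<omega>\<bar>" 1] g01[of \<omega>] by simp
      then show "integrable M (\<lambda>\<omega>. cos (s * Z m \<omega>) * g \<omega>)" by (intro intr) auto
    qed (simp add: distrib_right)
    ultimately show ?thesis using g1 by (simp add: algebra_simps)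
  qed
  have gsin: "(\<integral>\<omega>. sin (s * Z m \<omega>) * g \<omega> \<partial>M) = 0" for s
  proof -
    let ?h = "\<lambda>\<omega>. 1 + sin (s * Z m \<omega>)"
    have "(\<integral>\<omega>. ?h \<omega> * g \<omega> \<partial>M) = 1 * p"
    proof (rule tilt)
      show "0 \<le> ?h \<omega>" "?h \<omega> \<le> 2" "0 < (1::real)" for \<omega> using sin_ge_minus_one[of "s * Z m \<omega>"] sin_le_one[of "s * Z m \<omega>"] by linarith+
      fix t
      have "of_real (?h \<omega>) * iexp (T t \<omega>) = iexp (T t \<omega>) + (1/(2*\<i>)) * (iexp (T t \<omega>) * iexp (s * Z m \<omega>))
         + (-1/(2*\<i>)) * (iexp (T t \<omega>) * iexp (- s * Z m \<omega>))" for \<omega>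
        by (simp add: sin_of_real[symmetric] sin_exp_eq algebra_simps diff_divide_distrib)
      then have "(\<integral>\<omega>. of_real (?h \<omega>) * iexp (T t \<omega>) \<partial>M) = of_real (q t) + (1/(2*\<i>)) * of_real (q t * exp (- s\<^sup>2 / 2))
         + (-1/(2*\<i>)) * of_real (q t * exp (- (- s)\<^sup>2 / 2))"
        using E1[of t] Ep[of t s] Ep[of t "-s"] i1[of t] i2[of t s] i2[of t "-s"]
        by (simp only: Bochner_Integration.integral_add Bochner_Integration.integrable_add
            integral_mult_right_zero integrable_mult_right)
      then show "(\<integral>\<omega>. of_real (?h \<omega>) * iexp (T t \<omega>) \<partial>M) = of_real (1 * q t)"
        by simp
    qed measurable
    moreover have "(\<integral>\<omega>. ?h \<omega> * g \<omega> \<partial>M) = (\<integral>\<omega>. g \<omega> \<partial>M) + (\<integral>\<omega>. sin (s * Z m \<omega>) * g \<omega> \<partial>M)"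
    proof (subst Bochner_Integration.integral_add[symmetric])
      show "integrable M g" using g01 by (intro intr) (auto simp: order_trans[of _ 1])
      have "\<bar>sin (s * Z m \<omega>) * g \<omega>\<bar> \<le> 2" for \<omega>
        unfolding abs_mult using mult_mono[OF abs_sin_le_one[of "s * Z m \<omega>"], of "\<bar>g \<omega>\<bar>" 1] g01[of \<omega>] by simp
      then show "integrable M (\<lambda>\<omega>. sin (s * Z m \<omega>) * g \<omega>)" by (intro intr) auto
    qed (simp add: distrib_right)
    ultimately show ?thesis using g1 by (simp add: algebra_simps)
  qed
  have gi: "integrable M g" using g01 by (intro intr) (auto simp: order_trans[of _ 1])
  have "(\<integral>\<omega>. g \<omega> * indicat_real (A m) (Z m \<omega>) \<partial>M) = p * measure std_normal_distribution (A m)"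
  proof (cases "p = 0")
    case True
    have "(\<integral>\<omega>. g \<omega> * indicat_real (A m) (Z m \<omega>) \<partial>M) \<le> (\<integral>\<omega>. g \<omega> \<partial>M)"
      using g01 by (intro integral_mono' gi) (auto simp: indicator_def)
    moreover have "(\<integral>\<omega>. g \<omega> * indicat_real (A m) (Z m \<omega>) \<partial>M) \<ge> 0"
      using g01 by (intro integral_nonneg_AE) auto
    ultimately show ?thesis using True g1 by simp
  next
    case False
    have "p > 0" using False g1 g01 by (metis integral_nonneg_AE always_eventually less_le)
    let ?D = "density M (\<lambda>\<omega>. ennreal (g \<omega> / p))"
    note nd = normalized_density[OF _ g01(1) gi g1 \<open>p > 0\<close>]
    have Zd: "Z m \<in> borel_measurable ?D" by simp
    interpret D: prob_space ?D by (rule nd(1)) measurable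
    have "distr ?D borel (Z m) = std_normal_distribution"
    proof (rule Levy_uniqueness)
      show "real_distribution (distr ?D borel (Z m))"
        using Zd by (rule D.real_distribution_distr)
      show "char (distr ?D borel (Z m)) = char std_normal_distribution"
      proof
        fix s
        have i3: "integrable M (\<lambda>\<omega>. cos (s * Z m \<omega>) * g \<omega>)"
          using mult_mono[OF abs_cos_le_one[of "s * Z m _"], of "\<bar>g _\<bar>" 1] g01
          by (intro intr) (auto simp: abs_mult intro: order_trans[of _ 1])
        have i4: "integrable M (\<lambda>\<omega>. sin (s * Z m \<omega>) * g \<omega>)"
          using mult_mono[OF abs_sin_le_one[of "s * Z m _"], of "\<bar>g _\<bar>" 1] g01
          by (intro intr) (auto simp: abs_mult intro: order_trans[of _ 1])
        have "char (distr ?D borel (Z m)) s = (\<integral>\<omega>. iexp (s * Z m \<omega>) \<partial>?D)"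
          unfolding char_def by (rule integral_distr[OF Zd]) measurable
        also have "\<dots> = (1 / p) *\<^sub>R (\<integral>\<omega>. g \<omega> *\<^sub>R iexp (s * Z m \<omega>) \<partial>M)"
          by (rule nd(2)) measurable
        also have "(\<lambda>\<omega>. g \<omega> *\<^sub>R iexp (s * Z m \<omega>)) =
            (\<lambda>\<omega>. of_real (cos (s * Z m \<omega>) * g \<omega>) + \<i> * of_real (sin (s * Z m \<omega>) * g \<omega>))"
          by (rule ext) (simp add: scaleR_conv_of_real cis_conv_exp[symmetric] cis.ctr complex_eq_iff mult.commute
              flip: of_real_mult)
        also have "(\<integral>\<omega>. of_real (cos (s * Z m \<omega>) * g \<omega>) + \<i> * of_real (sin (s * Z m \<omega>) * g \<omega>) \<partial>M) =
          of_real (exp (- s\<^sup>2 / 2) * p) + \<i> * of_real 0"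
          unfolding gcos[symmetric] gsin[symmetric, of s] 
          by (subst Bochner_Integration.integral_add)
             (intro integrable_mult_right integrable_of_real i3 i4, intro integrable_mult_right integrable_of_real i3 i4,
              simp only: integral_mult_right_zero integral_complex_of_real)
        also have "(1 / p) *\<^sub>R \<dots> = char std_normal_distribution s"
          using \<open>p > 0\<close> by (simp add: char_std_normal_distribution scaleR_conv_of_real)
        finally show "char (distr ?D borel (Z m)) s = char std_normal_distribution s" .
      qed
    qed (rule real_dist_normal_dist)
    then have "measure std_normal_distribution (A m) = measure (distr ?D borel (Z m)) (A m)" by simp
    also have "\<dots> = (\<integral>y. indicator (A m) y \<partial>distr ?D borel (Z m))" by simp
    also have "\<dots> = (\<integral>\<omega>. indicator (A m) (Z m \<omega>) \<partial>?D)"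
      by (rule integral_distr[OF Zd]) measurable
    also have "\<dots> = (1 / p) *\<^sub>R (\<integral>\<omega>. g \<omega> *\<^sub>R indicator (A m) (Z m \<omega>) \<partial>M)"
      by (rule nd(2)) measurable
    finally show ?thesis using \<open>p > 0\<close> by simp
  qed
  then show ?case
    using insert.hyps by (simp add: g_def p_def mult.commute)
qed

lemma distr_PiM_std_normal_of_joint_char:
  fixes Z :: "'i \<Rightarrow> 'a \<Rightarrow> real"
  assumes I: "finite I" and M: "prob_space M" and Z: "\<And>k. k \<in> I \<Longrightarrow> Z k \<in> borel_measurable M"
    and ch: "\<And>t. (\<integral>\<omega>. iexp (\<Sum>k\<in>I. t k * Z k \<omega>) \<partial>M) = exp (- (\<Sum>k\<in>I. (t k)\<^sup>2) / 2)"
  shows "distr M (PiM I (\<lambda>_. std_normal_distribution)) (\<lambda>\<omega>. \<lambda>k\<in>I. Z k \<omega>) = PiM I (\<lambda>_. std_normal_distribution)"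
proof -
  interpret prob_space M by (rule M)
  define \<gamma> where "\<gamma> = std_normal_distribution"
  interpret \<gamma>: real_distribution \<gamma> unfolding \<gamma>_def by (rule real_dist_normal_dist)
  interpret product_sigma_finite "\<lambda>_. \<gamma>" ..
  have Zm [measurable]: "(\<lambda>\<omega>. \<lambda>k\<in>I. Z k \<omega>) \<in> measurable M (PiM I (\<lambda>_. \<gamma>))"
    using Z by (intro measurable_restrict) (simp add: measurable_cong_sets[OF refl \<gamma>.events_eq_borel])
  have "distr M (PiM I (\<lambda>_. \<gamma>)) (\<lambda>\<omega>. \<lambda>k\<in>I. Z k \<omega>) = PiM I (\<lambda>_. \<gamma>)"
  proof (rule PiM_eqI[OF I])
    fix A assume A: "\<And>k. k \<in> I \<Longrightarrow> A k \<in> sets \<gamma>"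
    have Ab: "A k \<in> sets borel" if "k \<in> I" for k using A[OF that] by simp
    let ?E = "(\<lambda>\<omega>. \<lambda>k\<in>I. Z k \<omega>) -` (Pi\<^sub>E I A) \<inter> space M"
    have PE: "Pi\<^sub>E I A \<in> sets (PiM I (\<lambda>_. \<gamma>))" using A I by (intro sets_PiM_I_finite) auto
    then have E: "?E \<in> sets M" by (rule measurable_sets[OF Zm])
    have "measure M ?E = (\<integral>\<omega>. indicat_real ?E \<omega> \<partial>M)" using E by simp
    also have "\<dots> = (\<integral>\<omega>. (\<Prod>k\<in>I. indicat_real (A k) (Z k \<omega>)) \<partial>M)"
    proof (rule Bochner_Integration.integral_cong[OF refl])
      fix \<omega> assume "\<omega> \<in> space M"
      then have "indicat_real ?E \<omega> = of_bool (\<forall>k\<in>I. Z k \<omega> \<in> A k)"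
        by (auto simp: indicator_def PiE_def Pi_def)
      also have "\<dots> = (\<Prod>k\<in>I. indicat_real (A k) (Z k \<omega>))"
        using I by (auto simp: indicator_def prod_zero_iff)
      finally show "indicat_real ?E \<omega> = (\<Prod>k\<in>I. indicat_real (A k) (Z k \<omega>))" .
    qed
    also have "\<dots> = (\<Prod>k\<in>I. measure \<gamma> (A k))"
      unfolding \<gamma>_def by (rule independent_std_normal_of_joint_char[OF I M Z ch Ab])
    finally show "emeasure (distr M (PiM I (\<lambda>_. \<gamma>)) (\<lambda>\<omega>. \<lambda>k\<in>I. Z k \<omega>)) (Pi\<^sub>E I A) = (\<Prod>k\<in>I. emeasure \<gamma> (A k))"
      using PE by (simp add: emeasure_distr emeasure_eq_measure \<gamma>.emeasure_eq_measure prod_ennreal)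
  qed simp
  then show ?thesis by (simp add: \<gamma>_def)
qed

lemma integral_prod_of_joint_char:
  fixes Z :: "'i \<Rightarrow> 'a \<Rightarrow> real" and f :: "real \<Rightarrow> complex"
  assumes I: "finite I" and M: "prob_space M" and Z: "\<And>k. k \<in> I \<Longrightarrow> Z k \<in> borel_measurable M"
    and ch: "\<And>t. (\<integral>\<omega>. iexp (\<Sum>k\<in>I. t k * Z k \<omega>) \<partial>M) = exp (- (\<Sum>k\<in>I. (t k)\<^sup>2) / 2)"
    and f [measurable]: "f \<in> borel_measurable borel" and f1: "\<And>z. norm (f z) \<le> 1"
  shows "(\<integral>\<omega>. (\<Prod>k\<in>I. f (Z k \<omega>)) \<partial>M) = (\<integral>z. f z \<partial>std_normal_distribution) ^ card I"
proof -
  define \<gamma> where "\<gamma> = std_normal_distribution"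
  interpret \<gamma>: real_distribution \<gamma> unfolding \<gamma>_def by (rule real_dist_normal_dist)
  interpret product_sigma_finite "\<lambda>_. \<gamma>" ..
  have Zm [measurable]: "(\<lambda>\<omega>. \<lambda>k\<in>I. Z k \<omega>) \<in> measurable M (PiM I (\<lambda>_. \<gamma>))"
    using Z by (intro measurable_restrict) (simp add: measurable_cong_sets[OF refl \<gamma>.events_eq_borel])
  have "(\<integral>z. f z \<partial>\<gamma>) ^ card I = (\<integral>z. (\<Prod>k\<in>I. f (z k)) \<partial>PiM I (\<lambda>_. \<gamma>))"
    by (subst product_integral_prod[OF I]) (auto intro!: \<gamma>.integrable_const_bound[of _ 1] simp: f1)
  also have "\<dots> = (\<integral>z. (\<Prod>k\<in>I. f (z k)) \<partial>distr M (PiM I (\<lambda>_. \<gamma>)) (\<lambda>\<omega>. \<lambda>k\<in>I. Z k \<omega>))"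
    unfolding \<gamma>_def by (subst distr_PiM_std_normal_of_joint_char[OF I M Z ch]) auto
  also have "\<dots> = (\<integral>\<omega>. (\<Prod>k\<in>I. f ((\<lambda>k\<in>I. Z k \<omega>) k)) \<partial>M)"
    by (rule integral_distr[OF Zm]) measurable
  also have "\<dots> = (\<integral>\<omega>. (\<Prod>k\<in>I. f (Z k \<omega>)) \<partial>M)" by simp
  finally show ?thesis by (simp add: \<gamma>_def)
qed

section \<open>The limit for independent normal coordinates\<close>

text \<open>The central limit theorem for \<open>r\<close> independent centred Bernoulli variables of parameter \<open>p\<close>, in terms of
  characteristic functions.\<close>

lemma char_centred_indicator_power_tendsto:
  fixes x :: real
  defines "p \<equiv> std_normal_cdf x"
  shows "(\<lambda>r. (\<integral>z. iexp (u / sqrt (real r) * (indicat_real {..x} z - p)) \<partial>std_normal_distribution) ^ r)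
    \<longlonglongrightarrow> exp (- (u\<^sup>2 * (p * (1 - p))) / 2)"
proof -
  define \<gamma> where "\<gamma> = std_normal_distribution"
  interpret \<gamma>: real_distribution \<gamma> unfolding \<gamma>_def by (rule real_dist_normal_dist)
  let ?Y = "\<lambda>z. indicat_real {..x} z - p"
  define v where "v = p * (1 - p)"
  have p: "0 < p" "p < 1" unfolding p_def by (rule std_normal_cdf_strict)+
  then have v: "0 \<le> v" "v \<le> 1" by (auto simp: v_def mult_le_one)
  have E1: "(\<integral>z. indicat_real {..x} z \<partial>\<gamma>) = p" by (simp add: p_def cdf_def \<gamma>_def)
  have i1 [simp]: "integrable \<gamma> (indicat_real {..x})" by (rule \<gamma>.integrable_const_bound[of _ 1]) auto
  have one: "\<gamma>.prob UNIV = 1" using \<gamma>.prob_space by simp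
  have mean: "\<gamma>.expectation ?Y = 0" using E1 by (simp add: one)
  have "(?Y z)\<^sup>2 = (1 - 2 * p) * indicat_real {..x} z + p\<^sup>2" for z
    by (auto simp: indicator_def power2_eq_square algebra_simps)
  then have "\<gamma>.expectation (\<lambda>z. (?Y z)\<^sup>2) = \<gamma>.expectation (\<lambda>z. (1 - 2 * p) * indicat_real {..x} z + p\<^sup>2)"
    by presburger
  also have "\<dots> = (1 - 2 * p) * p + p\<^sup>2"
    by (subst Bochner_Integration.integral_add)
       (use E1 in \<open>auto simp: one intro!: integrable_mult_right\<close>)
  finally have sq: "\<gamma>.expectation (\<lambda>z. (?Y z)\<^sup>2) = v"
    by (simp add: v_def power2_eq_square algebra_simps)
  have absY: "\<bar>?Y z\<bar> \<le> 1" for z using p by (auto simp: indicator_def)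
  have absY3: "\<bar>?Y z\<bar> ^ 3 \<le> 1" for z using absY[of z] by (intro power_le_one) auto
  have charY: "norm (\<gamma>.expectation (\<lambda>z. iexp (t * ?Y z)) - of_real (1 - t\<^sup>2 * v / 2)) \<le> \<bar>t\<bar> ^ 3 / 6" for t
  proof -
    have "norm (char (distr \<gamma> borel ?Y) t - (1 - t\<^sup>2 * v / 2)) \<le>
      (t\<^sup>2 / 6) * \<gamma>.expectation (\<lambda>z. min (6 * (?Y z)\<^sup>2) (\<bar>t\<bar> * \<bar>?Y z\<bar> ^ 3))"
    proof (rule \<gamma>.char_approx3'[OF _ _ _ mean _ refl])
      show "integrable \<gamma> (\<lambda>z. (?Y z)\<^sup>2)"
        using absY by (intro \<gamma>.integrable_const_bound[of _ 1]) (auto simp: abs_square_le_1)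
      show "\<gamma>.variance ?Y = v" using sq mean by simp
    qed auto
    also have "\<gamma>.expectation (\<lambda>z. min (6 * (?Y z)\<^sup>2) (\<bar>t\<bar> * \<bar>?Y z\<bar> ^ 3)) \<le> \<gamma>.expectation (\<lambda>z. \<bar>t\<bar>)"
    proof (rule integral_mono')
      fix z
      have "\<bar>t\<bar> * \<bar>?Y z\<bar> ^ 3 \<le> \<bar>t\<bar> * 1" by (intro mult_left_mono absY3) simp
      then show "min (6 * (?Y z)\<^sup>2) (\<bar>t\<bar> * \<bar>?Y z\<bar> ^ 3) \<le> \<bar>t\<bar>" by simp
    qed auto
    also have "(t\<^sup>2 / 6) * \<dots> = \<bar>t\<bar> ^ 3 / 6"
      by (simp add: one power3_eq_cube power2_eq_square[symmetric])
    also have "char (distr \<gamma> borel ?Y) t = \<gamma>.expectation (\<lambda>z. iexp (t * ?Y z))"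
      unfolding char_def by (subst integral_distr) auto
    finally show ?thesis by (simp add: mult_left_mono)
  qed
  let ?c = "\<lambda>r. \<gamma>.expectation (\<lambda>z. iexp (u / sqrt (real r) * ?Y z))"
  let ?d = "\<lambda>r. 1 + (- (u\<^sup>2 * v) / 2) / real r"
  have close: "norm (?c r ^ r - of_real (?d r ^ r)) \<le> \<bar>u\<bar> ^ 3 / 6 / sqrt (real r)"
    (* the second condition keeps the approximating factor in [-1, 1], as norm_power_diff requires *)
    if r: "r \<ge> 1" "real r \<ge> u\<^sup>2" for r
  proof -
    have "u\<^sup>2 * v \<le> real r * 1" using r v by (intro mult_mono) auto
    then have d1: "\<bar>?d r\<bar> \<le> 1" using r v by (auto simp: abs_le_iff field_simps)
    have c1: "norm (?c r) \<le> 1"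
      using integral_norm_bound[of \<gamma> "\<lambda>z. iexp (u / sqrt (real r) * ?Y z)"] by (simp add: one)
    have "norm (?c r ^ r - of_real (?d r) ^ r) \<le> real r * norm (?c r - of_real (?d r))"
      using c1 d1 by (intro norm_power_diff) (simp_all only: norm_of_real)
    also have "\<dots> \<le> real r * (\<bar>u / sqrt (real r)\<bar> ^ 3 / 6)"
    proof (rule mult_left_mono)
      have "1 - (u / sqrt (real r))\<^sup>2 * v / 2 = ?d r" by (simp add: power_divide)
      then show "norm (?c r - of_real (?d r)) \<le> \<bar>u / sqrt (real r)\<bar> ^ 3 / 6"
        using charY[of "u / sqrt (real r)"] by (metis of_real_1 of_real_diff)
    qed simp
    also have "\<dots> = \<bar>u\<bar> ^ 3 / 6 / sqrt (real r)"
      using r by (simp add: power_divide power3_eq_cube)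
    finally show ?thesis by simp
  qed
  have "(\<lambda>r. complex_of_real (?d r ^ r)) \<longlonglongrightarrow> complex_of_real (exp (- (u\<^sup>2 * v) / 2))"
    by (rule isCont_tendsto_compose [OF _ tendsto_exp_limit_sequentially]) auto
  moreover have "(\<lambda>r. ?c r ^ r - of_real (?d r ^ r)) \<longlonglongrightarrow> 0"
  proof (rule Lim_null_comparison)
    show "eventually (\<lambda>r. norm (?c r ^ r - of_real (?d r ^ r)) \<le> \<bar>u\<bar> ^ 3 / 6 / sqrt (real r)) sequentially"
      using eventually_ge_at_top[of "max 1 (nat \<lceil>u\<^sup>2\<rceil>)"]
      by eventually_elim (rule close; linarith)
    show "(\<lambda>r. \<bar>u\<bar> ^ 3 / 6 / sqrt (real r)) \<longlonglongrightarrow> 0"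
      by (intro tendsto_divide_0[OF tendsto_const] filterlim_at_top_imp_at_infinity
          filterlim_compose[OF sqrt_at_top filterlim_real_sequentially])
  qed
  ultimately have "(\<lambda>r. ?c r ^ r) \<longlonglongrightarrow> complex_of_real (exp (- (u\<^sup>2 * v) / 2))"
    by (rule Lim_transform)
  then show ?thesis by (simp add: v_def \<gamma>_def)
qed

section \<open>Moments of sums of kernels\<close>

text \<open>There are at most \<open>card R ^ 3\<close>, \<open>3 * card R ^ 2\<close> and \<open>card R\<close> triples with respectively three, two and one
  distinct entries.\<close>

lemma sum_power_card_triples_le:
  assumes R: "finite R" and \<epsilon>: "0 \<le> (\<epsilon>::real)"
  shows "(\<Sum>k\<in>R. \<Sum>l\<in>R. \<Sum>m\<in>R. \<epsilon> ^ card {k, l, m})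
    \<le> (real (card R) * \<epsilon>) ^ 3 + 3 * (real (card R) * \<epsilon>)\<^sup>2 + real (card R) * \<epsilon>"
proof -
  have "\<epsilon> ^ card {k, l, m} \<le> \<epsilon> ^ 3 + (of_bool (k = l) + of_bool (l = m) + of_bool (k = m)) * \<epsilon>\<^sup>2
      + of_bool (k = l \<and> l = m) * \<epsilon>" for k l m
  proof -
    consider "k = l" "l = m" | "k = l" "l \<noteq> m" | "k \<noteq> l" "l = m" | "k = m" "l \<noteq> m"
      | "k \<noteq> l" "l \<noteq> m" "k \<noteq> m" by blast
    then show ?thesis using \<epsilon> by cases (auto simp: power2_eq_square power3_eq_cube insert_commute)
  qed
  then have "(\<Sum>k\<in>R. \<Sum>l\<in>R. \<Sum>m\<in>R. \<epsilon> ^ card {k, l, m}) \<le>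
    (\<Sum>k\<in>R. \<Sum>l\<in>R. \<Sum>m\<in>R. \<epsilon> ^ 3 + (of_bool (k = l) + of_bool (l = m) + of_bool (k = m)) * \<epsilon>\<^sup>2
      + of_bool (k = l \<and> l = m) * \<epsilon>)"
    by (intro sum_mono)
  also have "\<dots> = (real (card R)) ^ 3 * \<epsilon> ^ 3 + 3 * (real (card R))\<^sup>2 * \<epsilon>\<^sup>2 + real (card R) * \<epsilon>"
  proof -
    have a: "(\<Sum>k\<in>R. \<Sum>l\<in>R. \<Sum>m\<in>R. of_bool (k = l)) = (real (card R))\<^sup>2"
      "(\<Sum>k\<in>R. \<Sum>l\<in>R. \<Sum>m\<in>R. of_bool (l = m)) = (real (card R))\<^sup>2"
      "(\<Sum>k\<in>R. \<Sum>l\<in>R. \<Sum>m\<in>R. of_bool (k = m)) = (real (card R))\<^sup>2"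
      using R by (simp_all add: of_bool_def power2_eq_square sum_distrib_left[symmetric] if_distrib cong: if_cong)
    have a': "(\<Sum>k\<in>R. \<Sum>l\<in>R. \<Sum>m\<in>R. of_bool (k = l \<and> l = m)) = real (card R)"
    proof -
      have "(\<Sum>k\<in>R. \<Sum>l\<in>R. \<Sum>m\<in>R. of_bool (k = l \<and> l = m)) =
          (\<Sum>k\<in>R. \<Sum>l\<in>R. of_bool (k = l) * (\<Sum>m\<in>R. of_bool (l = m) :: real))"
        unfolding of_bool_conj sum_distrib_left ..
      also have "\<dots> = (\<Sum>k\<in>R. \<Sum>l\<in>R. of_bool (k = l))"
        using R by (intro sum.cong refl) (simp add: of_bool_def)
      also have "\<dots> = real (card R)" using R by (simp add: of_bool_def)
      finally show ?thesis .
    qed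
    show ?thesis
      by (simp only: sum.distrib sum_distrib_right[symmetric] a a')
         (simp add: power2_eq_square power3_eq_cube algebra_simps)
  qed
  finally show ?thesis by (simp add: power_mult_distrib)
qed

text \<open>The cube of the sum is expanded. Since \<open>0 \<le> K \<le> 1\<close>, a repeated factor may be dropped, so each triple
  is controlled by the product over its set of distinct indices.\<close>

lemma (in prob_space) kernel_sum_moments:
  fixes K :: "'i \<Rightarrow> 'a \<Rightarrow> real"
  assumes R: "finite R" and K [measurable]: "\<And>k. k \<in> R \<Longrightarrow> K k \<in> borel_measurable M"
    and K01: "\<And>k \<omega>. 0 \<le> K k \<omega>" "\<And>k \<omega>. K k \<omega> \<le> 1" and \<epsilon>: "0 \<le> \<epsilon>" and b: "0 \<le> b"
    and E: "\<And>I. I \<subseteq> R \<Longrightarrow> card I \<le> 3 \<Longrightarrow> expectation (\<lambda>\<omega>. \<Prod>k\<in>I. K k \<omega>) \<le> b * \<epsilon> ^ card I"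
  shows "expectation (\<lambda>\<omega>. \<Sum>k\<in>R. K k \<omega>) \<le> b * (real (card R) * \<epsilon>)"
    and "expectation (\<lambda>\<omega>. (\<Sum>k\<in>R. K k \<omega>) ^ 3) \<le>
      b * ((real (card R) * \<epsilon>) ^ 3 + 3 * (real (card R) * \<epsilon>)\<^sup>2 + real (card R) * \<epsilon>)"
    and "integrable M (\<lambda>\<omega>. \<Sum>k\<in>R. K k \<omega>)" "integrable M (\<lambda>\<omega>. (\<Sum>k\<in>R. K k \<omega>) ^ 3)"
proof -
  have int: "integrable M (\<lambda>\<omega>. \<Prod>k\<in>I. K k \<omega>)" if "I \<subseteq> R" for I
  proof (rule integrable_const_bound[of _ 1])
    show "(\<lambda>\<omega>. \<Prod>k\<in>I. K k \<omega>) \<in> borel_measurable M"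
      using that by (intro borel_measurable_prod K) auto
  qed (auto simp: abs_prod K01 intro!: prod_le_1)
  have int1: "integrable M (K k)" if "k \<in> R" for k using int[of "{k}"] that by simp
  show "integrable M (\<lambda>\<omega>. \<Sum>k\<in>R. K k \<omega>)"
    using int1 by (rule Bochner_Integration.integrable_sum)
  have "expectation (\<lambda>\<omega>. \<Sum>k\<in>R. K k \<omega>) = (\<Sum>k\<in>R. expectation (K k))"
    using int1 by (rule Bochner_Integration.integral_sum)
  also have "\<dots> \<le> (\<Sum>k\<in>R. b * \<epsilon>)"
    using E[of "{_}"] by (intro sum_mono) auto
  finally show "expectation (\<lambda>\<omega>. \<Sum>k\<in>R. K k \<omega>) \<le> b * (real (card R) * \<epsilon>)"
    by (simp add: mult_ac)
  have cube: "(\<Sum>k\<in>R. K k \<omega>) ^ 3 = (\<Sum>k\<in>R. \<Sum>l\<in>R. \<Sum>m\<in>R. K k \<omega> * K l \<omega> * K m \<omega>)" for \<omega>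
    by (simp add: power3_eq_cube sum_product sum_distrib_right sum_distrib_left mult_ac)
  have Km: "K k \<omega> * K l \<omega> * K m \<omega> \<le> (\<Prod>i\<in>{k, l, m}. K i \<omega>)" for k l m \<omega>
  proof -
    have le: "a * c \<le> c" "c * a \<le> c" if "0 \<le> a" "a \<le> 1" "0 \<le> c" for a c :: real
      using that mult_right_mono[of a 1 c] by (simp_all add: mult.commute)
    have le': "K i \<omega> * K i \<omega> \<le> K i \<omega>" for i using K01 by (intro le) auto
    consider "k = l" "l = m" | "k = l" "l \<noteq> m" | "k \<noteq> l" "l = m" | "k = m" "l \<noteq> m"
      | "k \<noteq> l" "l \<noteq> m" "k \<noteq> m" by blast
    then show ?thesis
    proof cases
      case 1
      then show ?thesis using le[of "K m \<omega> * K m \<omega>" "K m \<omega>"] K01 le'[of m] by (simp add: mult_le_one)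
    next
      case 2
      then show ?thesis using K01 mult_right_mono[OF le'[of l], of "K m \<omega>"] by simp
    next
      case 3
      then show ?thesis using K01 mult_left_mono[OF le'[of l], of "K k \<omega>"] by (simp add: mult.assoc)
    next
      case 4
      then show ?thesis using K01 mult_left_mono[OF le'[of m], of "K l \<omega>"] by (simp add: insert_commute mult_ac)
    next
      case 5
      then show ?thesis by (simp add: mult.assoc)
    qed
  qed
  have sub: "{k, l, m} \<subseteq> R" if "k \<in> R" "l \<in> R" "m \<in> R" for k l m using that by auto
  have int3: "integrable M (\<lambda>\<omega>. K k \<omega> * K l \<omega> * K m \<omega>)" if "k \<in> R" "l \<in> R" "m \<in> R" for k l m
    by (rule Bochner_Integration.integrable_bound[OF int[OF sub[OF that]]])
       (use that Km K01 in \<open>auto simp: abs_mult abs_prod\<close>)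
  show "integrable M (\<lambda>\<omega>. (\<Sum>k\<in>R. K k \<omega>) ^ 3)"
    unfolding cube by (intro Bochner_Integration.integrable_sum int3)
  have "expectation (\<lambda>\<omega>. (\<Sum>k\<in>R. K k \<omega>) ^ 3) = (\<Sum>k\<in>R. \<Sum>l\<in>R. \<Sum>m\<in>R. expectation (\<lambda>\<omega>. K k \<omega> * K l \<omega> * K m \<omega>))"
    unfolding cube
    by (intro has_bochner_integral_integral_eq has_bochner_integral_sum has_bochner_integral_integrable int3)
  also have "\<dots> \<le> (\<Sum>k\<in>R. \<Sum>l\<in>R. \<Sum>m\<in>R. b * \<epsilon> ^ card {k, l, m})"
  proof (intro sum_mono)
    fix k l m assume klm: "k \<in> R" "l \<in> R" "m \<in> R"
    have "expectation (\<lambda>\<omega>. K k \<omega> * K l \<omega> * K m \<omega>) \<le> expectation (\<lambda>\<omega>. \<Prod>i\<in>{k, l, m}. K i \<omega>)"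
      by (intro integral_mono int3 int sub klm Km)
    also have "\<dots> \<le> b * \<epsilon> ^ card {k, l, m}"
      using klm by (intro E) (auto simp: card_insert_if)
    finally show "expectation (\<lambda>\<omega>. K k \<omega> * K l \<omega> * K m \<omega>) \<le> b * \<epsilon> ^ card {k, l, m}" .
  qed
  also have "\<dots> = b * (\<Sum>k\<in>R. \<Sum>l\<in>R. \<Sum>m\<in>R. \<epsilon> ^ card {k, l, m})"
    by (simp add: sum_distrib_left)
  also have "\<dots> \<le> b * ((real (card R) * \<epsilon>) ^ 3 + 3 * (real (card R) * \<epsilon>)\<^sup>2 + real (card R) * \<epsilon>)"
    using sum_power_card_triples_le[OF R \<epsilon>] b by (rule mult_left_mono)
  finally show "expectation (\<lambda>\<omega>. (\<Sum>k\<in>R. K k \<omega>) ^ 3) \<le>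
      b * ((real (card R) * \<epsilon>) ^ 3 + 3 * (real (card R) * \<epsilon>)\<^sup>2 + real (card R) * \<epsilon>)" .
qed

section \<open>The smoothed count\<close>

definition cos_sum :: "nat \<Rightarrow> nat set \<Rightarrow> nat \<Rightarrow> (nat \<Rightarrow> real) \<Rightarrow> real" where
  "cos_sum n J k w = (\<Sum>j\<in>J. cos_weight n j k * w j)"

lemma cos_sum_measurable:
  assumes "\<And>j. sets (\<nu> j) = sets borel"
  shows "cos_sum n J k \<in> borel_measurable (PiM J \<nu>)"
  unfolding cos_sum_def
proof (intro borel_measurable_sum borel_measurable_times borel_measurable_const)
  fix j assume "j \<in> J"
  then have "(\<lambda>w. w j) \<in> measurable (PiM J \<nu>) (\<nu> j)" by (rule measurable_component_singleton)
  then show "(\<lambda>w. w j) \<in> borel_measurable (PiM J \<nu>)"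
    using measurable_cong_sets[OF refl assms[of j]] by blast
qed

lemma norm_iexp_diff_le: "norm (iexp a - iexp b) \<le> \<bar>a - b\<bar>"
proof -
  have "iexp a = iexp b * iexp (a - b)"
    unfolding exp_add[symmetric] by (simp add: algebra_simps)
  then have "iexp a - iexp b = iexp b * (iexp (a - b) - 1)"
    by (simp only: right_diff_distrib mult_1_right)
  then have "norm (iexp a - iexp b) = norm (iexp (a - b) - 1)"
    by (simp only: norm_mult norm_exp_i_times mult_1_left)
  then show ?thesis using iexp_approx1[of "a - b" 0] by simp
qed

text \<open>The condition \<open>large\<close> says that \<open>r\<^sup>3 / n\<close> is small in terms of \<open>\<beta>\<close> and \<open>\<delta>\<close>. The constant
  \<open>3 / (2 * \<beta>)\<close> is the radius in which lemma \<open>norm_char_standardized_le\<close> applies, and 54 makes the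
  Chebyshev error of lemma \<open>anticoncentration\<close> at most \<open>\<epsilon>\<^sup>3\<close>.\<close>

locale smoothing_regime =
  fixes \<beta> \<delta> :: real and n r :: nat
  assumes \<beta>: "2 \<le> \<beta>" and \<delta>: "0 < \<delta>" "\<delta> \<le> 1" and r: "1 \<le> r"
    and large: "54 * real r ^ 3 \<le> (3 / (2 * \<beta>))\<^sup>2 * \<delta> ^ 5 * real n"
begin

definition \<epsilon> :: real where "\<epsilon> = \<delta> / sqrt (real r)"

lemma \<epsilon>: "0 < \<epsilon>" "\<epsilon> \<le> 1" "real r * \<epsilon> = \<delta> * sqrt (real r)"
proof -
  show "0 < \<epsilon>" using \<delta> r by (simp add: \<epsilon>_def)
  have "1 \<le> sqrt (real r)" using r by simp
  then have "\<delta> \<le> sqrt (real r)" using \<delta>(2) by linarith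
  then show "\<epsilon> \<le> 1" using r by (simp add: \<epsilon>_def)
  show "real r * \<epsilon> = \<delta> * sqrt (real r)"
    using r by (simp add: \<epsilon>_def real_div_sqrt field_simps)
qed

lemma n_ge: "54 * r \<le> n"
proof -
  have "real r \<le> real r ^ 3" using r power_increasing[of 1 3 "real r"] by simp
  then have "54 * real r \<le> (3 / (2 * \<beta>))\<^sup>2 * \<delta> ^ 5 * real n" using large by linarith
  also have "\<dots> \<le> 1 * 1 * real n"
    using \<beta> \<delta> by (intro mult_mono power_le_one) (auto simp: divide_le_eq)
  finally show ?thesis by linarith
qed

lemma freq: "k \<in> {1..r} \<Longrightarrow> 0 < k \<and> 2 * k < n"
  using n_ge by auto

text \<open>Put \<open>c = 3 / (2 * \<beta>)\<close>. With \<open>A = c * \<epsilon> / (3 * sqrt (2 / n))\<close> the error \<open>card I / A\<^sup>2\<close> is at most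
  \<open>54 / (c\<^sup>2 * \<epsilon>\<^sup>2 * n)\<close>. It is at most \<open>\<epsilon>\<^sup>3\<close> when \<open>c\<^sup>2 * \<epsilon>\<^sup>5 * n \<ge> 54\<close>, which follows from \<open>large\<close> since
  \<open>\<epsilon>\<^sup>5 = \<delta>\<^sup>5 / sqrt r ^ 5 \<ge> \<delta>\<^sup>5 / r\<^sup>3\<close>. Three
  indices suffice because only third derivatives occur.\<close>

lemma local_estimate:
  assumes law: "\<And>j. standardized_law \<beta> (\<nu> j)" and J: "{1..n} - {m} \<subseteq> J" "J \<subseteq> {1..n}"
    and I: "I \<subseteq> {1..r}" "card I \<le> 3"
  shows "(\<integral>w. (\<Prod>k\<in>I. gauss_kernel ((cos_sum n J k w - a k) / \<epsilon>)) \<partial>PiM J \<nu>) \<le> 9 * \<epsilon> ^ card I"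
proof -
  define c where "c = 3 / (2 * \<beta>)"
  define \<eta> where "\<eta> = sqrt (2 / real n)"
  define A where "A = c * \<epsilon> / (3 * \<eta>)"
  have n: "n > 0" "12 \<le> n" using n_ge r by auto
  have pos: "c > 0" "\<eta> > 0" "A > 0" using \<beta> n \<epsilon>(1) by (auto simp: c_def \<eta>_def A_def)
  have fin: "finite I" using I(1) by (rule finite_subset) simp
  have "(\<integral>w. (\<Prod>k\<in>I. gauss_kernel (((\<Sum>j\<in>J. cos_weight n j k * w j) - a k) / \<epsilon>)) \<partial>PiM J \<nu>)
    \<le> (2 * \<epsilon>) ^ card I + real (card I) / A\<^sup>2"
  proof (rule anticoncentration[OF law fin _ _ _ \<epsilon>(1) pos(3)])
    show "finite J" using J(2) by (rule finite_subset) simp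
    show "(\<Sum>k\<in>I. (u k)\<^sup>2) / 2 \<le> (\<Sum>j\<in>J. (\<Sum>k\<in>I. u k * cos_weight n j k)\<^sup>2)" for u
      using I freq n J by (intro cos_weight_almost_isometry[of I n m J] fin) auto
    show "\<bar>cos_weight n j k\<bar> \<le> \<eta>" for j k unfolding \<eta>_def by (rule abs_cos_weight_le)
    have "A / \<epsilon> * \<eta> = c / 3" using \<epsilon>(1) pos by (simp add: A_def)
    then have "real (card I) * (A / \<epsilon> * \<eta>) = real (card I) * (c / 3)" by (simp only:)
    also have "\<dots> \<le> 3 * (c / 3)" using I(2) pos by (intro mult_right_mono) auto
    finally show "real (card I) * (A / \<epsilon> * \<eta>) \<le> c" by simp
    show "c \<le> 1" "c * \<beta> \<le> 3 / 2" using \<beta> by (auto simp: c_def)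
  qed
  also have "real (card I) / A\<^sup>2 \<le> \<epsilon> ^ 3"
  proof -
    have "sqrt (real r) ^ 5 \<le> sqrt (real r) ^ 6" using r by (intro power_increasing) auto
    also have "sqrt (real r) ^ 6 = ((sqrt (real r))\<^sup>2) ^ 3" by (simp only: power_mult[symmetric]) simp
    also have "\<dots> = real r ^ 3" by simp
    finally have s5: "54 * sqrt (real r) ^ 5 \<le> c\<^sup>2 * \<delta> ^ 5 * real n"
      using large by (simp add: c_def)
    have s0: "sqrt (real r) ^ 5 > 0" using r by simp
    have "54 \<le> c\<^sup>2 * \<delta> ^ 5 * real n / sqrt (real r) ^ 5"
      using s5 s0 by (simp add: pos_le_divide_eq)
    also have "\<dots> = c\<^sup>2 * \<epsilon> ^ 5 * real n"
      by (simp add: \<epsilon>_def power_divide)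
    also have "\<epsilon> ^ 5 = \<epsilon> ^ 3 * \<epsilon>\<^sup>2" by (simp add: eval_nat_numeral)
    finally have "54 \<le> \<epsilon> ^ 3 * (c\<^sup>2 * \<epsilon>\<^sup>2 * real n)"
      by (simp only: mult_ac)
    then have "54 / (c\<^sup>2 * \<epsilon>\<^sup>2 * real n) \<le> \<epsilon> ^ 3"
      using pos \<epsilon>(1) n by (subst pos_divide_le_eq) auto
    moreover have "real (card I) / A\<^sup>2 \<le> 3 / A\<^sup>2"
      using I(2) by (intro divide_right_mono) auto
    moreover have "3 / A\<^sup>2 = 54 / (c\<^sup>2 * \<epsilon>\<^sup>2 * real n)"
      using n by (simp add: A_def \<eta>_def power_mult_distrib power_divide)
    ultimately show ?thesis by linarith
  qed
  also have "\<epsilon> ^ 3 \<le> \<epsilon> ^ card I" using \<epsilon> I(2) by (intro power_decreasing) auto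
  also have "(2 * \<epsilon>) ^ card I \<le> 8 * \<epsilon> ^ card I"
    using I(2) \<epsilon>(1) power_increasing[of "card I" 3 "2::real"]
    unfolding power_mult_distrib by (intro mult_right_mono) auto
  finally show ?thesis by (simp add: cos_sum_def)
qed

definition smooth_count :: "real \<Rightarrow> (nat \<Rightarrow> real) \<Rightarrow> real" where
  "smooth_count x w = (\<Sum>k=1..r. smooth_step 0 ((cos_sum n {1..n} k w - x) / \<epsilon>))"

text \<open>Each of the \<open>r\<close> indicators is changed by at most the kernel, whose mean is at most \<open>9 * \<epsilon>\<close>, and
  \<open>r * \<epsilon> = \<delta> * sqrt r\<close>. The bound is applied with \<open>\<theta>\<close> proportional to \<open>1 / sqrt r\<close>.\<close>

lemma smoothing_error:
  assumes law: "\<And>j. standardized_law \<beta> (\<nu> j)"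
  shows "norm ((\<integral>w. iexp (\<theta> * (\<Sum>k=1..r. indicat_real {..x} (cos_sum n {1..n} k w))) \<partial>PiM {1..n} \<nu>) -
      (\<integral>w. iexp (\<theta> * smooth_count x w) \<partial>PiM {1..n} \<nu>)) \<le> 9 * \<bar>\<theta>\<bar> * \<delta> * sqrt (real r)"
proof -
  note L = standardized_lawD[OF law]
  let ?P = "PiM {1..n} \<nu>"
  interpret prob_space ?P by (rule prob_space_PiM) (rule L(2))
  note [measurable] = cos_sum_measurable[where \<nu> = \<nu>, OF L(3)]
  let ?K = "\<lambda>k w. gauss_kernel ((cos_sum n {1..n} k w - x) / \<epsilon>)"
  let ?N = "\<lambda>w. \<Sum>k=1..r. indicat_real {..x} (cos_sum n {1..n} k w)"
  have [measurable]: "smooth_count x \<in> borel_measurable ?P" unfolding smooth_count_def by measurable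
  have i1: "integrable ?P (\<lambda>w. iexp (\<theta> * ?N w))" "integrable ?P (\<lambda>w. iexp (\<theta> * smooth_count x w))"
    by (rule integrable_iexp; measurable)+
  have iK: "integrable ?P (?K k)" for k
    by (rule integrable_const_bound[of _ 1], simp add: gauss_kernel_le_1 gauss_kernel_pos less_imp_le, measurable)
  have EK: "expectation (?K k) \<le> 9 * \<epsilon>" if "k \<in> {1..r}" for k
    using local_estimate[where I = "{k}" and J = "{1..n}" and m = 0 and a = "\<lambda>_. x", OF law] that by simp
  have pt: "norm (iexp (\<theta> * ?N w) - iexp (\<theta> * smooth_count x w)) \<le> \<bar>\<theta>\<bar> * (\<Sum>k=1..r. ?K k w)" for w
  proof -
    have "norm (iexp (\<theta> * ?N w) - iexp (\<theta> * smooth_count x w)) \<le> \<bar>\<theta> * ?N w - \<theta> * smooth_count x w\<bar>"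
      by (rule norm_iexp_diff_le)
    also have "\<dots> = \<bar>\<theta>\<bar> * \<bar>smooth_count x w - ?N w\<bar>" 
      unfolding right_diff_distrib[symmetric] abs_mult by (subst abs_minus_commute) (rule refl)
    also have "\<dots> \<le> \<bar>\<theta>\<bar> * (\<Sum>k=1..r. ?K k w)"
    proof (rule mult_left_mono)
      have ind: "indicat_real {..x} y = indicat_real {..0} ((y - x) / \<epsilon>)" for y
        using \<epsilon>(1) by (auto simp: indicator_def divide_le_0_iff)
      show "\<bar>smooth_count x w - ?N w\<bar> \<le> (\<Sum>k=1..r. ?K k w)"
        unfolding smooth_count_def sum_subtractf[symmetric] ind
        by (intro order_trans[OF sum_abs] sum_mono smooth_step_approx)
    qed simp
    finally show ?thesis .
  qed
  have "norm ((\<integral>w. iexp (\<theta> * ?N w) \<partial>?P) - (\<integral>w. iexp (\<theta> * smooth_count x w) \<partial>?P)) =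
      norm (\<integral>w. iexp (\<theta> * ?N w) - iexp (\<theta> * smooth_count x w) \<partial>?P)"
    by (subst Bochner_Integration.integral_diff[OF i1]) (rule refl)
  also have "\<dots> \<le> (\<integral>w. norm (iexp (\<theta> * ?N w) - iexp (\<theta> * smooth_count x w)) \<partial>?P)"
    by (rule integral_norm_bound)
  also have "\<dots> \<le> (\<integral>w. \<bar>\<theta>\<bar> * (\<Sum>k=1..r. ?K k w) \<partial>?P)"
  proof (rule integral_mono'[OF _ pt])
    show "integrable ?P (\<lambda>w. \<bar>\<theta>\<bar> * (\<Sum>k=1..r. ?K k w))"
      by (intro integrable_mult_right Bochner_Integration.integrable_sum iK)
    show "0 \<le> \<bar>\<theta>\<bar> * (\<Sum>k=1..r. ?K k w)" for w
      by (intro mult_nonneg_nonneg sum_nonneg abs_ge_zero less_imp_le gauss_kernel_pos)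
  qed
  also have "\<dots> = \<bar>\<theta>\<bar> * (\<Sum>k=1..r. expectation (?K k))"
    by (subst integral_mult_right_zero, subst Bochner_Integration.integral_sum[OF iK]) (rule refl)
  also have "\<dots> \<le> \<bar>\<theta>\<bar> * (\<Sum>k=1..r. 9 * \<epsilon>)"
    by (intro mult_left_mono sum_mono EK) auto
  also have "\<dots> = 9 * \<bar>\<theta>\<bar> * (real r * \<epsilon>)" by simp
  also have "\<dots> = 9 * \<bar>\<theta>\<bar> * \<delta> * sqrt (real r)" unfolding \<epsilon>(3) by (simp only: mult.assoc)
  finally show ?thesis .
qed

end

section \<open>Exchanging all laws\<close>

definition phase_constant :: "real \<Rightarrow> real" where
  "phase_constant u = 8 * \<bar>u\<bar> + 192 * u\<^sup>2 + 512 * \<bar>u\<bar> ^ 3"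

lemma phase_constant_nonneg: "0 \<le> phase_constant u"
  by (simp add: phase_constant_def)

text \<open>With \<open>s = sqrt r\<close> and \<open>\<epsilon> = \<delta> / s\<close>, an \<open>i\<close>-th derivative of the smoothed count is at most
  \<open>8 * (\<eta> / \<epsilon>)\<^sup>i * Q\<close>, where \<open>\<eta>\<close> bounds the coefficients and \<open>Q\<close> is the sum of the kernels. The
  normalisation \<open>u / s\<close> of the phase then leaves \<open>s\<^sup>2 * Q\<close>, \<open>s * Q\<^sup>2\<close> and \<open>Q\<^sup>3\<close>, all of order \<open>s\<^sup>3\<close>
  on average; the middle one is bounded by the other two.\<close>

lemma phase_weight_le:
  assumes s: "s > 0" and \<delta>: "\<delta> > 0" and \<eta>: "0 \<le> \<eta>" and Q: "0 \<le> Q"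
    and Y: "\<And>i. i \<in> {1, 2, 3} \<Longrightarrow> \<bar>Y i t\<bar> \<le> 8 * (\<eta> * s / \<delta>) ^ i * Q"
  shows "phase_weight (u / s) Y t \<le> phase_constant u * (\<eta> / \<delta>) ^ 3 * (s\<^sup>2 * Q + Q ^ 3)"
proof -
  define g where "g = \<eta> * s / \<delta>"
  have g: "0 \<le> g" using s \<delta> \<eta> by (simp add: g_def)
  have Y': "\<bar>Y 1 t\<bar> \<le> 8 * g * Q" "\<bar>Y 2 t\<bar> \<le> 8 * g\<^sup>2 * Q" "\<bar>Y 3 t\<bar> \<le> 8 * g ^ 3 * Q"
    using Y[of 1] Y[of 2] Y[of 3] by (simp_all add: g_def)
  have cube: "0 \<le> s\<^sup>2 * Q" "0 \<le> Q ^ 3" using Q by auto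
  have "0 \<le> (s - Q)\<^sup>2" by simp
  then have "2 * (s * Q) \<le> s\<^sup>2 + Q\<^sup>2" by (simp add: power2_eq_square algebra_simps)
  moreover have "0 \<le> s * Q" using s Q by simp
  ultimately have "s * Q \<le> s\<^sup>2 + Q\<^sup>2" by linarith
  then have "s * Q * Q \<le> (s\<^sup>2 + Q\<^sup>2) * Q" using Q by (rule mult_right_mono)
  then have mid: "s * Q\<^sup>2 \<le> s\<^sup>2 * Q + Q ^ 3"
    by (simp add: power2_eq_square power3_eq_cube algebra_simps)
  have "phase_weight (u / s) Y t \<le> \<bar>u / s\<bar> * (8 * g ^ 3 * Q) +
      3 * (u / s)\<^sup>2 * (8 * g * Q) * (8 * g\<^sup>2 * Q) + \<bar>u / s\<bar> ^ 3 * (8 * g * Q) ^ 3"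
    unfolding phase_weight_def using Y' g Q
    by (intro add_mono mult_mono mult_left_mono power_mono mult_nonneg_nonneg) auto
  also have "\<dots> = (\<eta> / \<delta>) ^ 3 * (8 * \<bar>u\<bar> * (s\<^sup>2 * Q) + 192 * u\<^sup>2 * (s * Q\<^sup>2) + 512 * \<bar>u\<bar> ^ 3 * Q ^ 3)"
    using s \<delta> by (simp add: g_def power_divide power_mult_distrib abs_divide field_simps
        power2_eq_square power3_eq_cube)
  also have "\<dots> \<le> (\<eta> / \<delta>) ^ 3 * (8 * \<bar>u\<bar> * (s\<^sup>2 * Q + Q ^ 3) + 192 * u\<^sup>2 * (s\<^sup>2 * Q + Q ^ 3) +
      512 * \<bar>u\<bar> ^ 3 * (s\<^sup>2 * Q + Q ^ 3))"
    using cube mid \<eta> \<delta> by (intro mult_left_mono add_mono) auto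
  also have "\<dots> = phase_constant u * (\<eta> / \<delta>) ^ 3 * (s\<^sup>2 * Q + Q ^ 3)"
    unfolding phase_constant_def by (simp only: distrib_left distrib_right mult_ac)
  finally show ?thesis .
qed

context smoothing_regime
begin

definition swap_cost :: "real \<Rightarrow> real" where
  "swap_cost u = 54 * phase_constant u * (sqrt (2 / real n) / \<delta>) ^ 3 * sqrt (real r) ^ 3"

lemma swap_cost_nonneg: "0 \<le> swap_cost u"
  using \<delta> by (simp add: swap_cost_def phase_constant_nonneg)

text \<open>The variable \<open>t\<close> with index \<open>m\<close> moves the centres of the kernels by \<open>t * cos_weight n m k\<close>. Because
  \<open>local_estimate\<close> holds for arbitrary centres \<open>a\<close>, the moments of the kernel sum are bounded uniformly
  in \<open>t\<close>, as \<open>lindeberg_swap\<close> demands.\<close>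

lemma lindeberg_step:
  fixes u x :: real
  assumes law: "\<And>j. standardized_law \<beta> (\<nu> j)" and J: "J = {1..n} - {m}"
    and \<mu>: "standardized_law \<beta> \<mu>1" "standardized_law \<beta> \<mu>2"
  defines "F \<equiv> \<lambda>w t. iexp (u / sqrt (real r) *
      (\<Sum>k=1..r. smooth_step 0 ((cos_sum n J k w + t * cos_weight n m k - x) / \<epsilon>)))"
  shows "norm ((\<integral>w. (\<integral>t. F w t \<partial>\<mu>1) \<partial>PiM J \<nu>) - (\<integral>w. (\<integral>t. F w t \<partial>\<mu>2) \<partial>PiM J \<nu>)) \<le> \<beta> * swap_cost u"
proof -
  note L = standardized_lawD[OF law]
  let ?P = "PiM J \<nu>"
  interpret prob_space ?P by (rule prob_space_PiM) (rule L(2))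
  have [measurable]: "cos_sum n J k \<in> borel_measurable ?P" for k by (rule cos_sum_measurable) (rule L(3))
  define z where "z k w t = (cos_sum n J k w + t * cos_weight n m k - x) / \<epsilon>" for k w t
  define v where "v k = cos_weight n m k / \<epsilon>" for k
  define Y where "Y i w t = (\<Sum>k=1..r. smooth_step i (z k w t) * v k ^ i)" for i w t
  define Q where "Q w t = (\<Sum>k=1..r. gauss_kernel (z k w t))" for w t
  let ?s = "sqrt (real r)" and ?\<eta> = "sqrt (2 / real n)"
  have s1: "1 \<le> ?s" using r by simp
  have zD: "((\<lambda>t. z k w t) has_real_derivative v k) (at t)" for k w t
    unfolding z_def v_def using \<epsilon>(1) by (auto intro!: derivative_eq_intros)
  have YD: "(Y i w has_real_derivative Y (Suc i) w t) (at t)" if "i < 3" for i w t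
  proof -
    have "((\<lambda>t. smooth_step i (z k w t) * v k ^ i) has_real_derivative
        smooth_step (Suc i) (z k w t) * v k ^ Suc i) (at t)" for k
      using DERIV_cmult_right[OF DERIV_chain2[OF DERIV_smooth_step[OF that] zD[of k w t]], where c = "v k ^ i"]
      by (simp add: mult.assoc)
    then show ?thesis unfolding Y_def[abs_def] by (intro DERIV_sum)
  qed
  have contz: "continuous_on UNIV (\<lambda>t. z k w t)" for k w
    by (rule DERIV_continuous_on) (rule has_field_derivative_at_within[OF zD])
  have contY: "continuous_on UNIV (Y 3 w)" for w
    unfolding Y_def[abs_def]
    by (intro continuous_on_sum continuous_on_mult continuous_on_const
        continuous_on_compose2[OF continuous_on_smooth_step contz]) auto
  have zm [measurable]: "(\<lambda>(w, t). z k w t) \<in> borel_measurable (?P \<Otimes>\<^sub>M borel)" for k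
    unfolding z_def split_beta' by measurable
  have Ym: "(\<lambda>(w, t). Y i w t) \<in> borel_measurable (?P \<Otimes>\<^sub>M borel)" for i
    unfolding Y_def split_beta'
    by (intro borel_measurable_sum borel_measurable_times borel_measurable_const
        measurable_compose[OF zm[unfolded split_beta'] smooth_step_measurable])
  have Q0: "0 \<le> Q w t" for w t
    unfolding Q_def by (intro sum_nonneg less_imp_le gauss_kernel_pos)
  have weight: "phase_weight (u / ?s) (\<lambda>i. Y i w) t \<le>
      phase_constant u * (?\<eta> / \<delta>) ^ 3 * (?s\<^sup>2 * Q w t + Q w t ^ 3)" for w t
  proof (rule phase_weight_le)
    fix i :: nat assume i: "i \<in> {1, 2, 3}"
    have "\<bar>v k\<bar> \<le> ?\<eta> * ?s / \<delta>" for k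
    proof -
      have "\<bar>v k\<bar> \<le> ?\<eta> / \<epsilon>"
        unfolding v_def abs_divide using \<epsilon>(1) abs_cos_weight_le by (simp add: divide_right_mono)
      then show ?thesis by (simp add: \<epsilon>_def)
    qed
    then have "\<bar>smooth_step i (z k w t) * v k ^ i\<bar> \<le> 8 * gauss_kernel (z k w t) * (?\<eta> * ?s / \<delta>) ^ i" for k
      unfolding abs_mult power_abs using i
      by (intro mult_mono power_mono abs_smooth_step_le) (auto simp: gauss_kernel_pos less_imp_le)
    then have "\<bar>Y i w t\<bar> \<le> (\<Sum>k=1..r. 8 * gauss_kernel (z k w t) * (?\<eta> * ?s / \<delta>) ^ i)"
      unfolding Y_def by (intro order.trans[OF sum_abs sum_mono])
    then show "\<bar>Y i w t\<bar> \<le> 8 * (?\<eta> * ?s / \<delta>) ^ i * Q w t"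
      by (simp add: Q_def sum_distrib_left sum_distrib_right mult_ac)
  qed (use s1 \<delta> Q0 in auto)
  have EQ: "expectation (\<lambda>w. Q w t) \<le> 9 * (real r * \<epsilon>)"
    "expectation (\<lambda>w. Q w t ^ 3) \<le> 9 * ((real r * \<epsilon>) ^ 3 + 3 * (real r * \<epsilon>)\<^sup>2 + real r * \<epsilon>)"
    "integrable ?P (\<lambda>w. Q w t)" "integrable ?P (\<lambda>w. Q w t ^ 3)" for t
  proof -
    have K [measurable]: "(\<lambda>w. gauss_kernel (z k w t)) \<in> borel_measurable ?P" for k
      unfolding z_def by measurable
    have E: "expectation (\<lambda>w. \<Prod>k\<in>I. gauss_kernel (z k w t)) \<le> 9 * \<epsilon> ^ card I"
      if "I \<subseteq> {1..r}" "card I \<le> 3" for I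
      using local_estimate[where a = "\<lambda>k. x - t * cos_weight n m k" and m = m, OF law _ _ that, of J] J
      by (simp add: z_def algebra_simps)
    have "finite {1..r}" by simp
    note * = kernel_sum_moments[OF this K gauss_kernel_pos[THEN less_imp_le] gauss_kernel_le_1 less_imp_le[OF \<epsilon>(1)] _ E]
    show "expectation (\<lambda>w. Q w t) \<le> 9 * (real r * \<epsilon>)"
      "expectation (\<lambda>w. Q w t ^ 3) \<le> 9 * ((real r * \<epsilon>) ^ 3 + 3 * (real r * \<epsilon>)\<^sup>2 + real r * \<epsilon>)"
      "integrable ?P (\<lambda>w. Q w t)" "integrable ?P (\<lambda>w. Q w t ^ 3)"
      using * by (simp_all add: Q_def)
  qed
  have D: "(\<integral>\<^sup>+w. ennreal (phase_weight (u / ?s) (\<lambda>i. Y i w) t) \<partial>?P) \<le> ennreal (swap_cost u)" for t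
  proof -
    let ?C = "phase_constant u * (?\<eta> / \<delta>) ^ 3"
    have C: "0 \<le> ?C" using \<delta> by (simp add: phase_constant_nonneg)
    have "(\<integral>\<^sup>+w. ennreal (phase_weight (u / ?s) (\<lambda>i. Y i w) t) \<partial>?P) \<le> (\<integral>\<^sup>+w. ennreal (?C * (?s\<^sup>2 * Q w t + Q w t ^ 3)) \<partial>?P)"
      by (intro nn_integral_mono ennreal_leI weight)
    also have "\<dots> = ennreal (\<integral>w. ?C * (?s\<^sup>2 * Q w t + Q w t ^ 3) \<partial>?P)"
    proof (rule nn_integral_eq_integral)
      show "integrable ?P (\<lambda>w. ?C * (?s\<^sup>2 * Q w t + Q w t ^ 3))"
        by (intro integrable_mult_right Bochner_Integration.integrable_add EQ)
      show "AE w in ?P. 0 \<le> ?C * (?s\<^sup>2 * Q w t + Q w t ^ 3)"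
        by (intro always_eventually allI mult_nonneg_nonneg[OF C] add_nonneg_nonneg mult_nonneg_nonneg zero_le_power Q0 zero_le_power2)
    qed
    also have "(\<integral>w. ?C * (?s\<^sup>2 * Q w t + Q w t ^ 3) \<partial>?P) = ?C * (?s\<^sup>2 * expectation (\<lambda>w. Q w t) + expectation (\<lambda>w. Q w t ^ 3))"
      by (subst integral_mult_right_zero, subst Bochner_Integration.integral_add[OF integrable_mult_right[OF EQ(3)] EQ(4)],
          subst integral_mult_right_zero) (rule refl)
    also have "\<dots> \<le> ?C * (54 * ?s ^ 3)"
    proof (rule mult_left_mono[OF _ C])
      have e: "real r * \<epsilon> \<le> ?s" using \<epsilon>(3) \<delta> s1 by (simp add: mult_left_le_one_le)
      have e0: "0 \<le> real r * \<epsilon>" using \<epsilon>(1) by simp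
      have s2: "?s\<^sup>2 \<le> ?s ^ 3" "?s \<le> ?s ^ 3"
        using s1 power_increasing[of 2 3 ?s] power_increasing[of 1 3 ?s] by simp_all
      have "?s\<^sup>2 * expectation (\<lambda>w. Q w t) \<le> ?s\<^sup>2 * (9 * ?s)"
        using EQ(1)[of t] e by (intro mult_left_mono) auto
      also have "\<dots> = 9 * ?s ^ 3" by (simp only: power2_eq_square power3_eq_cube mult_ac)
      finally have 1: "?s\<^sup>2 * expectation (\<lambda>w. Q w t) \<le> 9 * ?s ^ 3" .
      have "(real r * \<epsilon>) ^ 3 \<le> ?s ^ 3" "(real r * \<epsilon>)\<^sup>2 \<le> ?s\<^sup>2"
        by (intro power_mono e e0)+
      then have "9 * ((real r * \<epsilon>) ^ 3 + 3 * (real r * \<epsilon>)\<^sup>2 + real r * \<epsilon>) \<le> 9 * (?s ^ 3 + 3 * ?s ^ 3 + ?s ^ 3)"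
        using s2 e by (intro mult_left_mono add_mono order_refl) auto
      then show "?s\<^sup>2 * expectation (\<lambda>w. Q w t) + expectation (\<lambda>w. Q w t ^ 3) \<le> 54 * ?s ^ 3"
        using 1 EQ(2)[of t] by simp
    qed
    also have "?C * (54 * ?s ^ 3) = swap_cost u" by (simp only: swap_cost_def mult_ac)
    finally show ?thesis by (simp add: ennreal_leI)
  qed
  have "F w t = iexp (u / ?s * Y 0 w t)" for w t by (simp add: F_def Y_def z_def)
  then show ?thesis
    using lindeberg_swap[OF \<mu> Ym YD contY D swap_cost_nonneg] by simp
qed

text \<open>In the mixed family \<open>\<nu> p\<close> the first \<open>p\<close> variables have their law from \<open>\<mu>\<close> and the others from \<open>\<gamma>\<close>; consecutive
  families differ in one variable, so \<open>lindeberg_step\<close> bounds each of the \<open>n\<close> differences.\<close>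

lemma lindeberg_total:
  fixes u x :: real
  assumes \<mu>: "\<And>j. standardized_law \<beta> (\<mu> j)" and \<gamma>: "\<And>j. standardized_law \<beta> (\<gamma> j)"
  defines "F \<equiv> \<lambda>w. iexp (u / sqrt (real r) * smooth_count x w)"
  shows "norm ((\<integral>w. F w \<partial>PiM {1..n} \<mu>) - (\<integral>w. F w \<partial>PiM {1..n} \<gamma>)) \<le> real n * (\<beta> * swap_cost u)"
proof -
  define \<nu> where "\<nu> p j = (if j \<le> p then \<mu> j else \<gamma> j)" for p j :: nat
  have \<nu>: "standardized_law \<beta> (\<nu> p j)" for p j using \<mu> \<gamma> by (simp add: \<nu>_def)
  define H where "H p = (\<integral>w. F w \<partial>PiM {1..n} (\<nu> p))" for p
  have step: "norm (H (Suc p) - H p) \<le> \<beta> * swap_cost u" if p: "p < n" for p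
  proof -
    define J where "J = {1..n} - {Suc p}"
    have ins: "{1..n} = insert (Suc p) J" and fin: "finite J" and notin: "Suc p \<notin> J" using p by (auto simp: J_def)
    define G where "G w t = iexp (u / sqrt (real r) *
      (\<Sum>k=1..r. smooth_step 0 ((cos_sum n J k w + t * cos_weight n (Suc p) k - x) / \<epsilon>)))" for w t
    have split: "(\<integral>w. F w \<partial>PiM {1..n} (\<nu> q)) = (\<integral>w. (\<integral>t. G w t \<partial>\<nu> q (Suc p)) \<partial>PiM J (\<nu> q))" for q
    proof -
      note L = standardized_lawD[OF \<nu>[of q]]
      interpret real_distribution "\<nu> q j" for j by (rule L)
      interpret product_sigma_finite "\<nu> q" ..
      interpret P: prob_space "PiM {1..n} (\<nu> q)" by (rule prob_space_PiM) (rule L(2))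
      have [measurable]: "cos_sum n {1..n} k \<in> borel_measurable (PiM {1..n} (\<nu> q))" for k
        by (rule cos_sum_measurable) (rule L(3))
      have [measurable]: "smooth_count x \<in> borel_measurable (PiM {1..n} (\<nu> q))"
        unfolding smooth_count_def by measurable
      have "integrable (PiM {1..n} (\<nu> q)) F"
        unfolding F_def by (rule P.integrable_iexp; measurable)
      then have "(\<integral>w. F w \<partial>PiM {1..n} (\<nu> q)) = (\<integral>w. (\<integral>t. F (w(Suc p := t)) \<partial>\<nu> q (Suc p)) \<partial>PiM J (\<nu> q))"
        unfolding ins by (rule product_integral_insert[OF fin notin])
      moreover have "F (w(Suc p := t)) = G w t" for w t
      proof -
        have "cos_sum n {1..n} k (w(Suc p := t)) = cos_sum n J k w + t * cos_weight n (Suc p) k" for k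
        proof -
          have "(\<Sum>j\<in>J. cos_weight n j k * (w(Suc p := t)) j) = (\<Sum>j\<in>J. cos_weight n j k * w j)"
            using notin by (intro sum.cong) auto
          then show ?thesis unfolding cos_sum_def ins using fin notin by simp
        qed
        then show ?thesis by (simp only: F_def G_def smooth_count_def)
      qed
      ultimately show ?thesis by simp
    qed
    have "PiM J (\<nu> (Suc p)) = PiM J (\<nu> p)"
      by (rule PiM_cong) (auto simp: \<nu>_def J_def le_Suc_eq)
    then have "H (Suc p) = (\<integral>w. (\<integral>t. G w t \<partial>\<nu> (Suc p) (Suc p)) \<partial>PiM J (\<nu> p))"
      "H p = (\<integral>w. (\<integral>t. G w t \<partial>\<nu> p (Suc p)) \<partial>PiM J (\<nu> p))"
      by (simp_all only: H_def split)
    then show ?thesis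
      unfolding G_def by (simp only: lindeberg_step[OF \<nu> J_def \<nu> \<nu>])
  qed
  have "norm (H p - H 0) \<le> real p * (\<beta> * swap_cost u)" if "p \<le> n" for p
    using that
  proof (induction p)
    case (Suc p)
    have "norm (H (Suc p) - H 0) \<le> norm (H (Suc p) - H p) + norm (H p - H 0)"
      using norm_triangle_ineq[of "H (Suc p) - H p" "H p - H 0"] by simp
    also have "\<dots> \<le> \<beta> * swap_cost u + real p * (\<beta> * swap_cost u)"
      using Suc by (intro add_mono step) auto
    finally show ?case by (simp add: algebra_simps)
  qed simp
  moreover have "PiM {1..n} (\<nu> n) = PiM {1..n} \<mu>" "PiM {1..n} (\<nu> 0) = PiM {1..n} \<gamma>"
    by (rule PiM_cong; auto simp: \<nu>_def)+
  ultimately show ?thesis using H_def by (metis order_refl)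
qed

end

section \<open>The limit theorem\<close>

lemma (in prob_space) standardized_law_distr:
  assumes [measurable]: "random_variable borel Y" and "expectation Y = 0" "expectation (\<lambda>\<omega>. (Y \<omega>)\<^sup>2) = 1"
    and \<tau>: "\<tau> > 0" and exp: "(\<integral>\<^sup>+\<omega>. ennreal (\<bar>Y \<omega>\<bar> ^ 3 * exp (\<bar>Y \<omega>\<bar> / \<tau>)) \<partial>M) \<le> ennreal \<tau>"
  shows "standardized_law \<tau> (distr M borel Y)"
proof -
  have "(\<integral>\<^sup>+\<omega>. ennreal (\<bar>Y \<omega>\<bar> ^ 3) \<partial>M) \<le> (\<integral>\<^sup>+\<omega>. ennreal (\<bar>Y \<omega>\<bar> ^ 3 * exp (\<bar>Y \<omega>\<bar> / \<tau>)) \<partial>M)"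
  proof (intro nn_integral_mono ennreal_leI)
    fix \<omega>
    have "1 \<le> exp (\<bar>Y \<omega>\<bar> / \<tau>)" using \<tau> by simp
    then show "\<bar>Y \<omega>\<bar> ^ 3 \<le> \<bar>Y \<omega>\<bar> ^ 3 * exp (\<bar>Y \<omega>\<bar> / \<tau>)"
      using mult_left_mono[of 1 "exp (\<bar>Y \<omega>\<bar> / \<tau>)" "\<bar>Y \<omega>\<bar> ^ 3"] by simp
  qed
  also note exp
  finally have le: "(\<integral>\<^sup>+\<omega>. ennreal (\<bar>Y \<omega>\<bar> ^ 3) \<partial>M) \<le> ennreal \<tau>" .
  have int: "integrable M (\<lambda>\<omega>. \<bar>Y \<omega>\<bar> ^ 3)"
    using le by (intro integrableI_nonneg) (auto simp: top_unique less_top[symmetric] intro: le_less_trans)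
  have "ennreal (expectation (\<lambda>\<omega>. \<bar>Y \<omega>\<bar> ^ 3)) \<le> ennreal \<tau>"
    using le int by (subst nn_integral_eq_integral[symmetric]) auto
  then have "expectation (\<lambda>\<omega>. \<bar>Y \<omega>\<bar> ^ 3) \<le> \<tau>" using \<tau> by (simp add: ennreal_le_iff)
  then show ?thesis
    using assms(2,3) int by (simp add: standardized_law_def integrable_distr_eq integral_distr real_distribution_distr)
qed

lemma normal_law_centred:
  assumes v: "v > 0"
  shows "real_distribution (normal_law 0 v)" "char (normal_law 0 v) u = of_real (exp (- (u\<^sup>2 * v) / 2))"
proof -
  interpret real_distribution std_normal_distribution by (rule real_dist_normal_dist)
  have "distributed std_normal_distribution lborel (\<lambda>y. y) std_normal_density"
    by (simp add: distributed_def distr_id2)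
  then have "distributed std_normal_distribution lborel (\<lambda>y. 0 + sqrt v * y) (normal_density (0 + sqrt v * 0) (\<bar>sqrt v\<bar> * 1))"
    by (rule normal_density_affine) (use v in auto)
  then have "distr std_normal_distribution lborel (\<lambda>y. sqrt v * y) = normal_law 0 v"
    using v by (simp add: distributed_def normal_law_def)
  then have eq: "normal_law 0 v = distr std_normal_distribution borel (\<lambda>y. sqrt v * y)"
    by (simp cong: distr_cong)
  show "real_distribution (normal_law 0 v)"
    unfolding eq by (rule real_distribution_distr) simp
  have "char (normal_law 0 v) u = (\<integral>y. iexp (u * (sqrt v * y)) \<partial>std_normal_distribution)"
    unfolding eq char_def by (rule integral_distr) auto
  also have "\<dots> = char std_normal_distribution (u * sqrt v)"
    by (simp add: char_def mult.assoc)
  finally show "char (normal_law 0 v) u = of_real (exp (- (u\<^sup>2 * v) / 2))"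
    using v by (simp add: char_std_normal_distribution power_mult_distrib)
qed

text \<open>The characteristic function at \<open>u\<close> of the normalised count when the variables are independent
  with laws \<open>\<nu>\<close>.\<close>

definition count_char :: "real \<Rightarrow> real \<Rightarrow> nat \<Rightarrow> nat \<Rightarrow> (nat \<Rightarrow> real measure) \<Rightarrow> complex" where
  "count_char u x r n \<nu> = (\<integral>w. iexp (u / sqrt (real r) *
      (\<Sum>k=1..r. indicat_real {..x} (cos_sum n {1..n} k w) - std_normal_cdf x)) \<partial>PiM {1..n} \<nu>)"

lemma count_char_eq:
  "count_char u x r n \<nu> = iexp (- (u / sqrt (real r) * (real r * std_normal_cdf x))) *
    (\<integral>w. iexp (u / sqrt (real r) * (\<Sum>k=1..r. indicat_real {..x} (cos_sum n {1..n} k w))) \<partial>PiM {1..n} \<nu>)"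
proof -
  have "u / sqrt (real r) * (\<Sum>k=1..r. indicat_real {..x} (cos_sum n {1..n} k w) - std_normal_cdf x) =
      - (u / sqrt (real r) * (real r * std_normal_cdf x)) +
      u / sqrt (real r) * (\<Sum>k=1..r. indicat_real {..x} (cos_sum n {1..n} k w))" for w
    by (simp add: sum_subtractf right_diff_distrib)
  then show ?thesis
    unfolding count_char_def by (simp only: of_real_add distrib_left exp_add integral_mult_right_zero)
qed

text \<open>Smoothing is paid for twice, once for each family of laws.\<close>

lemma (in smoothing_regime) count_char_universality:
  assumes \<mu>: "\<And>j. standardized_law \<beta> (\<mu> j)" and \<gamma>: "\<And>j. standardized_law \<beta> (\<gamma> j)"
  shows "norm (count_char u x r n \<mu> - count_char u x r n \<gamma>) \<le>
    18 * \<bar>u\<bar> * \<delta> + real n * (\<beta> * swap_cost u)"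
proof -
  define N where "N \<nu> = (\<integral>w. iexp (u / sqrt (real r) * (\<Sum>k=1..r. indicat_real {..x} (cos_sum n {1..n} k w))) \<partial>PiM {1..n} \<nu>)" for \<nu>
  define S where "S \<nu> = (\<integral>w. iexp (u / sqrt (real r) * smooth_count x w) \<partial>PiM {1..n} \<nu>)" for \<nu>
  have NS: "norm (N \<nu> - S \<nu>) \<le> 9 * \<bar>u\<bar> * \<delta>" if "\<And>j. standardized_law \<beta> (\<nu> j)" for \<nu>
  proof -
    have "norm (N \<nu> - S \<nu>) \<le> 9 * \<bar>u / sqrt (real r)\<bar> * \<delta> * sqrt (real r)"
      unfolding N_def S_def by (rule smoothing_error[OF that])
    then show ?thesis using r by simp
  qed
  have SS: "norm (S \<mu> - S \<gamma>) \<le> real n * (\<beta> * swap_cost u)"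
    unfolding S_def by (rule lindeberg_total[OF \<mu> \<gamma>])
  have "count_char u x r n \<mu> - count_char u x r n \<gamma> =
      iexp (- (u / sqrt (real r) * (real r * std_normal_cdf x))) * (N \<mu> - N \<gamma>)"
    unfolding count_char_eq N_def by (simp only: right_diff_distrib)
  then have "norm (count_char u x r n \<mu> - count_char u x r n \<gamma>) = norm (N \<mu> - N \<gamma>)"
    by (simp only: norm_mult norm_exp_i_times mult_1_left)
  also have "N \<mu> - N \<gamma> = (N \<mu> - S \<mu>) + (S \<mu> - S \<gamma>) - (N \<gamma> - S \<gamma>)" by simp
  also have "norm \<dots> \<le> norm (N \<mu> - S \<mu>) + norm (S \<mu> - S \<gamma>) + norm (N \<gamma> - S \<gamma>)"
    by (intro order_trans[OF norm_triangle_ineq4] add_right_mono norm_triangle_ineq)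
  also have "\<dots> \<le> 9 * \<bar>u\<bar> * \<delta> + real n * (\<beta> * swap_cost u) + 9 * \<bar>u\<bar> * \<delta>"
    by (intro add_mono NS SS \<mu> \<gamma>)
  finally show ?thesis by (simp add: algebra_simps)
qed

text \<open>For normal variables the transform is an orthonormal image of a standard normal vector, so its
  entries are independent.\<close>

lemma count_char_gaussian:
  assumes r: "2 * r < n"
  shows "count_char u x r n (\<lambda>_. std_normal_distribution) =
    (\<integral>z. iexp (u / sqrt (real r) * (indicat_real {..x} z - std_normal_cdf x)) \<partial>std_normal_distribution) ^ r"
proof -
  define \<gamma> where "\<gamma> = std_normal_distribution"
  have \<gamma>: "real_distribution \<gamma>" unfolding \<gamma>_def by (rule real_dist_normal_dist)
  interpret \<gamma>: real_distribution \<gamma> by (rule \<gamma>)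
  let ?P = "PiM {1..n} (\<lambda>_. \<gamma>)"
  let ?f = "\<lambda>z. iexp (u / sqrt (real r) * (indicat_real {..x} z - std_normal_cdf x))"
  have "count_char u x r n (\<lambda>_. \<gamma>) = (\<integral>w. (\<Prod>k\<in>{1..r}. ?f (cos_sum n {1..n} k w)) \<partial>?P)"
    unfolding count_char_def by (simp only: exp_sum[OF finite_atLeastAtMost, symmetric] of_real_sum sum_distrib_left)
  also have "\<dots> = (\<integral>z. ?f z \<partial>std_normal_distribution) ^ card {1..r}"
  proof (rule integral_prod_of_joint_char)
    show "prob_space ?P" by (rule prob_space_PiM) unfold_locales
    show "cos_sum n {1..n} k \<in> borel_measurable ?P" for k by (rule cos_sum_measurable) simp
    fix t :: "nat \<Rightarrow> real"
    have "(\<Sum>k\<in>{1..r}. t k * cos_sum n {1..n} k w) = (\<Sum>j\<in>{1..n}. (\<Sum>k\<in>{1..r}. t k * cos_weight n j k) * w j)" for w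
      unfolding cos_sum_def sum_distrib_left sum_distrib_right by (subst sum.swap) (simp only: mult.assoc)
    then have "(\<integral>w. iexp (\<Sum>k\<in>{1..r}. t k * cos_sum n {1..n} k w) \<partial>?P) =
        (\<Prod>j\<in>{1..n}. char \<gamma> (\<Sum>k\<in>{1..r}. t k * cos_weight n j k))"
      by (simp only: char_PiM_linear[OF \<gamma> finite_atLeastAtMost])
    also have "\<dots> = of_real (\<Prod>j\<in>{1..n}. exp (- (\<Sum>k\<in>{1..r}. t k * cos_weight n j k)\<^sup>2 / 2))"
      unfolding \<gamma>_def char_std_normal_distribution of_real_prod ..
    also have "(\<Prod>j\<in>{1..n}. exp (- (\<Sum>k\<in>{1..r}. t k * cos_weight n j k)\<^sup>2 / 2)) =
        exp (- (\<Sum>j\<in>{1..n}. (\<Sum>k\<in>{1..r}. t k * cos_weight n j k)\<^sup>2) / 2)"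
      unfolding exp_sum[OF finite_atLeastAtMost, symmetric] sum_divide_distrib[symmetric] sum_negf ..
    also have "(\<Sum>j\<in>{1..n}. (\<Sum>k\<in>{1..r}. t k * cos_weight n j k)\<^sup>2) = (\<Sum>k\<in>{1..r}. (t k)\<^sup>2)"
      using r by (intro cos_weight_isometry) auto
    finally show "(\<integral>w. iexp (\<Sum>k\<in>{1..r}. t k * cos_sum n {1..n} k w) \<partial>?P) = exp (- (\<Sum>k\<in>{1..r}. (t k)\<^sup>2) / 2)" .
  qed auto
  finally show ?thesis by (simp add: \<gamma>_def)
qed

text \<open>The cost of the \<open>n\<close> swaps is a constant depending on \<open>\<delta>\<close> times \<open>sqrt (r\<^sup>3 / n)\<close>, because
  \<open>n * sqrt (2 / n) ^ 3 = 2 * sqrt (2 / n)\<close>. Hence \<open>\<delta>\<close> is fixed first, so that smoothing costs at most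
  half of \<open>e\<close>, and then \<open>n\<close> is taken large.\<close>

lemma count_char_difference_tendsto_0:
  fixes r :: "nat \<Rightarrow> nat"
  assumes \<mu>: "\<And>j. standardized_law \<beta> (\<mu> j)" and \<gamma>: "\<And>j. standardized_law \<beta> (\<gamma> j)" and \<beta>: "2 \<le> \<beta>"
    and r: "\<And>n. n \<ge> 1 \<Longrightarrow> r n > 0" and growth: "(\<lambda>n. real (r n) ^ 3 / real n) \<longlonglongrightarrow> 0"
  shows "(\<lambda>n. count_char u x (r n) n \<mu> - count_char u x (r n) n \<gamma>) \<longlonglongrightarrow> 0"
proof (rule LIMSEQ_I)
  fix e :: real assume e: "0 < e"
  (* the smoothing cost 18 * abs u * delta becomes at most e / 2; adding 1 to abs u covers u = 0 *)
  define \<delta> where "\<delta> = min 1 (e / (36 * (\<bar>u\<bar> + 1)))"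
  have \<delta>: "0 < \<delta>" "\<delta> \<le> 1" "\<delta> \<le> e / (36 * (\<bar>u\<bar> + 1))" using e by (auto simp: \<delta>_def)
  have "36 * (\<bar>u\<bar> * \<delta>) \<le> 36 * ((\<bar>u\<bar> + 1) * \<delta>)" using \<delta> by (simp add: mult_right_mono)
  also have "\<dots> \<le> 36 * ((\<bar>u\<bar> + 1) * (e / (36 * (\<bar>u\<bar> + 1))))" using \<delta> by (intro mult_left_mono) auto
  also have "\<dots> = e"
  proof -
    have "36 * (a * (e / (36 * a))) = e" if "a \<noteq> 0" for a :: real using that by simp
    note this[of "\<bar>u\<bar> + 1"]
    then show ?thesis by linarith
  qed
  finally have smooth: "18 * \<bar>u\<bar> * \<delta> \<le> e / 2" by simp
  define C where "C = 108 * \<beta> * phase_constant u / \<delta> ^ 3"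
  have "(\<lambda>n. C * sqrt (2 * (real (r n) ^ 3 / real n))) \<longlonglongrightarrow> C * sqrt (2 * 0)"
    by (intro tendsto_intros growth)
  then have "(\<lambda>n. C * sqrt (2 * (real (r n) ^ 3 / real n))) \<longlonglongrightarrow> 0" by simp
  then have ev1: "eventually (\<lambda>n. C * sqrt (2 * (real (r n) ^ 3 / real n)) < e / 2) sequentially"
    using e by (intro order_tendstoD(2)) auto
  define c where "c = (3 / (2 * \<beta>))\<^sup>2 * \<delta> ^ 5 / 54"
  have "c > 0" using \<beta> \<delta> by (simp add: c_def)
  with growth have ev2: "eventually (\<lambda>n. real (r n) ^ 3 / real n < c) sequentially"
    by (intro order_tendstoD(2))
  have "eventually (\<lambda>n. norm (count_char u x (r n) n \<mu> - count_char u x (r n) n \<gamma> - 0) < e) sequentially"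
    using ev1 ev2 eventually_ge_at_top[of 1]
  proof eventually_elim
    case (elim n)
    have "real (r n) ^ 3 \<le> c * real n" using elim by (simp add: pos_divide_less_eq)
    then interpret smoothing_regime \<beta> \<delta> n "r n"
      using \<beta> \<delta> r[OF elim(3)] by unfold_locales (auto simp: c_def)
    let ?\<eta> = "sqrt (2 / real n)"
    have "real n * ?\<eta> ^ 3 = 2 * ?\<eta>"
      using elim by (simp add: power3_eq_cube)
    then have "real n * (\<beta> * swap_cost u) = C * (?\<eta> * sqrt (real (r n)) ^ 3)"
      by (simp add: swap_cost_def C_def power_divide field_simps)
    also have "?\<eta> * sqrt (real (r n)) ^ 3 = sqrt (2 * (real (r n) ^ 3 / real n))"
      by (simp add: real_sqrt_power[symmetric] real_sqrt_mult[symmetric])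
    finally have "real n * (\<beta> * swap_cost u) < e / 2" using elim by simp
    moreover have "norm (count_char u x (r n) n \<mu> - count_char u x (r n) n \<gamma>) \<le>
        18 * \<bar>u\<bar> * \<delta> + real n * (\<beta> * swap_cost u)"
      by (rule count_char_universality[OF \<mu> \<gamma>])
    ultimately show ?case using smooth by simp
  qed
  then show "\<exists>no. \<forall>n\<ge>no. norm (count_char u x (r n) n \<mu> - count_char u x (r n) n \<gamma> - 0) < e"
    by (simp add: eventually_sequentially)
qed

theorem proposition1p2:
  fixes M :: "'a measure"
    and X :: "nat \<Rightarrow> 'a \<Rightarrow> real"
    and \<tau> :: real
    and r :: "nat \<Rightarrow> nat"
    and x :: real
  assumes "prob_space M"
    and "prob_space.indep_vars M (\<lambda>_. borel) X {1..}"
    and "\<And>j. j \<ge> 1 \<Longrightarrow> prob_space.expectation M (X j) = 0"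
    and "\<And>j. j \<ge> 1 \<Longrightarrow> prob_space.expectation M (\<lambda>\<omega>. (X j \<omega>)\<^sup>2) = 1"
    and "\<tau> > 0"
    and "(SUP k\<in>{1..}. \<integral>\<^sup>+ \<omega>. ennreal (\<bar>X k \<omega>\<bar> ^ 3 * exp (\<bar>X k \<omega>\<bar> / \<tau>)) \<partial>M) \<le> ennreal \<tau>"
    and "\<And>n. n \<ge> 1 \<Longrightarrow> r n > 0"
    and "filterlim r at_top sequentially"
    and "(\<lambda>n. (ln (real n))\<^sup>2 / real n * real (r n) ^ 3) \<longlonglongrightarrow> 0"
  shows "weak_conv_m
      (\<lambda>n. distr M borel (\<lambda>\<omega>. 1 / sqrt (real (r n)) *
          (\<Sum>k = 1..r n. (indicat_real {..x} (cos_transform X n k \<omega>) - std_normal_cdf x))))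
      (normal_law 0 (std_normal_cdf x * (1 - std_normal_cdf x)))"
proof -
  interpret prob_space M by (rule assms(1))
  define p where "p = std_normal_cdf x"
  have p: "0 < p * (1 - p)" using std_normal_cdf_strict[of x] by (simp add: p_def)
  have X [measurable]: "random_variable borel (X j)" if "j \<ge> 1" for j
    using assms(2) that by (auto simp: indep_vars_def)
  define \<beta> where "\<beta> = max 2 \<tau>"
  (* index 0 is not among the given variables; a normal law there makes the family total *)
  define \<mu> where "\<mu> j = (if j \<ge> 1 then distr M borel (X j) else std_normal_distribution)" for j :: nat
  have \<gamma>: "standardized_law \<beta> std_normal_distribution"
    using standardized_law_std_normal by (rule standardized_law_mono) (simp add: \<beta>_def)
  have \<mu>: "standardized_law \<beta> (\<mu> j)" for j
  proof (cases "j \<ge> 1")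
    case True
    have "(\<integral>\<^sup>+ \<omega>. ennreal (\<bar>X j \<omega>\<bar> ^ 3 * exp (\<bar>X j \<omega>\<bar> / \<tau>)) \<partial>M) \<le> ennreal \<tau>"
      using True by (intro order_trans[OF SUP_upper assms(6)]) simp
    then have "standardized_law \<tau> (distr M borel (X j))"
      using True assms(3-5) by (intro standardized_law_distr X) auto
    then show ?thesis
      using True by (auto simp: \<mu>_def \<beta>_def intro: standardized_law_mono)
  qed (simp add: \<mu>_def \<gamma>)
  let ?T = "\<lambda>n \<omega>. 1 / sqrt (real (r n)) *
      (\<Sum>k = 1..r n. (indicat_real {..x} (cos_transform X n k \<omega>) - std_normal_cdf x))"
  have cos_transform: "cos_transform X n k \<omega> = cos_sum n {1..n} k (\<lambda>j\<in>{1..n}. X j \<omega>)" for n k \<omega>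
    unfolding cos_transform_def cos_sum_def cos_weight_def sum_distrib_left
    by (intro sum.cong) (auto simp: mult.assoc)
  have [measurable]: "(\<lambda>\<omega>. cos_transform X n k \<omega>) \<in> borel_measurable M" for n k
    unfolding cos_transform_def
    by (intro borel_measurable_times borel_measurable_const borel_measurable_sum X) auto
  have char_T: "char (distr M borel (?T n)) u = count_char u x (r n) n \<mu>" if n: "n \<ge> 1" for n u
  proof -
    let ?X = "\<lambda>\<omega>. \<lambda>j\<in>{1..n}. X j \<omega>"
    have Xm: "?X \<in> measurable M (PiM {1..n} (\<lambda>_. borel))" by (intro measurable_restrict X) auto
    have "indep_vars (\<lambda>_. borel) X {1..n}"
      using assms(2) by (rule indep_vars_subset) auto
    then have "distr M (PiM {1..n} (\<lambda>_. borel)) ?X = PiM {1..n} (\<lambda>j. distr M borel (X j))"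
      using n X by (subst (asm) indep_vars_iff_distr_eq_PiM') auto
    also have "\<dots> = PiM {1..n} \<mu>" by (rule PiM_cong) (auto simp: \<mu>_def)
    finally have law: "PiM {1..n} \<mu> = distr M (PiM {1..n} (\<lambda>_. borel)) ?X" ..
    have cm [measurable]: "cos_sum n {1..n} k \<in> borel_measurable (PiM {1..n} (\<lambda>_. borel))" for k
      by (rule cos_sum_measurable) simp
    have "char (distr M borel (?T n)) u = (\<integral>\<omega>. iexp (u * ?T n \<omega>) \<partial>M)"
      unfolding char_def by (rule integral_distr) measurable
    also have "\<dots> = (\<integral>\<omega>. iexp (u / sqrt (real (r n)) *
        (\<Sum>k=1..r n. indicat_real {..x} (cos_sum n {1..n} k (?X \<omega>)) - std_normal_cdf x)) \<partial>M)"
      unfolding cos_transform by simp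
    also have "\<dots> = count_char u x (r n) n \<mu>"
      unfolding count_char_def law by (rule integral_distr[OF Xm, symmetric]) measurable
    finally show ?thesis .
  qed
  have growth: "(\<lambda>n. real (r n) ^ 3 / real n) \<longlonglongrightarrow> 0"
  proof (rule Lim_null_comparison[OF _ assms(9)])
    show "eventually (\<lambda>n. norm (real (r n) ^ 3 / real n) \<le> (ln (real n))\<^sup>2 / real n * real (r n) ^ 3) sequentially"
      using eventually_ge_at_top[of 3]
    proof eventually_elim
      case (elim n)
      (* the squared logarithm is at least 1 here *)
      have "exp 1 \<le> real n" using exp_le elim by linarith
      then have "1 \<le> ln (real n)" using elim by (subst ln_ge_iff) auto
      then have "1 * (real (r n) ^ 3 / real n) \<le> (ln (real n))\<^sup>2 * (real (r n) ^ 3 / real n)"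
        by (intro mult_right_mono) (auto simp: one_le_power)
      then show ?case by simp
    qed
  qed
  have sparse: "eventually (\<lambda>n. 2 * r n < n) sequentially"
  proof -
    have "eventually (\<lambda>n. real (r n) ^ 3 / real n < 1 / 2) sequentially"
      using growth by (rule order_tendstoD(2)) simp
    then show ?thesis
      using eventually_ge_at_top[of 1]
    proof eventually_elim
      case (elim n)
      have "real (r n) \<le> real (r n) ^ 3"
        using assms(7)[OF elim(2)] power_increasing[of 1 3 "real (r n)"] by simp
      then have "real (2 * r n) \<le> real (r n) ^ 3 * 2" by simp
      also have "\<dots> < real n" using elim by (simp add: pos_divide_less_eq)
      finally have "real (2 * r n) < real n" .
      then show ?case by (simp only: of_nat_less_iff)
    qed
  qed
  show ?thesis
  proof (rule levy_continuity)
    show "real_distribution (distr M borel (?T n))" for n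
      by (rule real_distribution_distr) measurable
    show "real_distribution (normal_law 0 (std_normal_cdf x * (1 - std_normal_cdf x)))"
      using p unfolding p_def by (rule normal_law_centred)
    fix u
    let ?c = "\<lambda>m. (\<integral>z. iexp (u / sqrt (real m) * (indicat_real {..x} z - std_normal_cdf x)) \<partial>std_normal_distribution) ^ m"
    have lim: "char (normal_law 0 (std_normal_cdf x * (1 - std_normal_cdf x))) u =
        exp (- (u\<^sup>2 * (std_normal_cdf x * (1 - std_normal_cdf x))) / 2)"
      using p unfolding p_def by (rule normal_law_centred)
    have "(\<lambda>n. ?c (r n)) \<longlonglongrightarrow> exp (- (u\<^sup>2 * (std_normal_cdf x * (1 - std_normal_cdf x))) / 2)"
      by (rule filterlim_compose[OF char_centred_indicator_power_tendsto assms(8)])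
    then have "(\<lambda>n. count_char u x (r n) n (\<lambda>_. std_normal_distribution))
        \<longlonglongrightarrow> exp (- (u\<^sup>2 * (std_normal_cdf x * (1 - std_normal_cdf x))) / 2)"
      by (rule Lim_transform_eventually) (use sparse in \<open>eventually_elim, simp only: count_char_gaussian\<close>)
    moreover have "(\<lambda>n. count_char u x (r n) n \<mu> - count_char u x (r n) n (\<lambda>_. std_normal_distribution)) \<longlonglongrightarrow> 0"
      by (rule count_char_difference_tendsto_0[OF \<mu> \<gamma> _ assms(7) growth]) (simp add: \<beta>_def)
    ultimately have "(\<lambda>n. count_char u x (r n) n \<mu>)
        \<longlonglongrightarrow> exp (- (u\<^sup>2 * (std_normal_cdf x * (1 - std_normal_cdf x))) / 2)"
      by (rule Lim_transform)
    then show "(\<lambda>n. char (distr M borel (?T n)) u)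
        \<longlonglongrightarrow> char (normal_law 0 (std_normal_cdf x * (1 - std_normal_cdf x))) u"
      unfolding lim
      by (rule Lim_transform_eventually)
         (use eventually_ge_at_top[of 1] in \<open>eventually_elim, simp only: char_T\<close>)
  qed
qed

end
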